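(* Let $l\in\mathbb Z_{\ge 0}$ and $\lambda=l(l-1)/2$, and let $q\in\mathbb Z_4=\{0,1,2,3\}$. Let $H_l$ be the $\mathfrak{sl}_2$-module of $K$-finite solutions (for the parameter $q$) defined in the context. If $q=0$ or $q=2$, then $H_l$ is irreducible as an $\mathfrak{sl}_2$-module. If $q=1$ (respectively, $q=3$), then $H_l$ has a unique lowest (respectively, highest) weight submodule, denoted $H_l^-$ (respectively, $H_l^+$).
   Context: Fix $q\in\mathbb Z_4$, $r=-1/2$, $s=i/2$. Let $I''(q,r,s)$ be the complex vector space of all $F\in C^\infty(\mathbb R^2)$, $F=F(\theta,y)$ complex valued, with $F(\theta+j\pi,(-1)^jy)=i^{-jq}F(\theta,y)$ for all $j\in\mathbb Z$. (This is the "compact picture" of a representation of $\widetilde{SL(2,\mathbb R)}\ltimes H_3$ smoothly induced from a character of a parabolic-like subgroup; $\widetilde{SL(2,\mathbb R)}$ is the two-fold cover and $H_3$ the three-dimensional Heisenberg group.) The group $K\cong\mathbb R/4\pi\mathbb Z$ acts by translation in $\theta$. A nonzero $F$ of the form $F(\theta,y)=e^{-im\theta/2}\tilde F(y)$, $m\in\mathbb Z$, is a weight vector of weight $m$; a vector is $K$-finite if it is a finite linear combination of weight vectors. Let $\{h,e^+,e^-\}$ be the standard $\mathfrak{sl}_2$-triple of $\mathfrak{sl}(2,\mathbb R)$, and put $\kappa=i(e^--e^+)$, $\eta^\pm=\tfrac12\bigl(h\pm i(e^++e^-)\bigr)$, a basis of $\mathfrak{sl}(2,\mathbb C)$. The action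 of $\mathfrak{sl}_2$ on $I''(q,r,s)$ is by the differential operators $$\kappa=i\partial_\theta,\qquad \eta^\pm=\tfrac12e^{\mp2i\theta}\Bigl(-y\partial_y\mp i\partial_\theta-\tfrac12\pm y^2\Bigr).$$ Let $\Omega=\tfrac12h^2-h+2e^+e^-$ be the Casimir element. The element $\Omega'=2\Omega-r(r+2)$ acts on $I''(q,r,s)$ by $\Omega''=y^2(2i\partial_\theta-y^2+\partial_y^2)$. (The eigenvalue equation $\Omega''F=2\lambda F$ corresponds to $\Omega f=(\tfrac{r(r+2)}2+\lambda)f$, i.e. to solutions of the Schrödinger equation $2iu_t+u_{xx}=2\lambda x^{-2}u$.) Definition of $H_l$: for $l\ge2$ and $\lambda=l(l-1)/2$, $H_l$ is the space of $K$-finite vectors of $\ker(\Omega''-2\lambda)\subset I''(q,r,s)$. For $\lambda=0$, the space of $K$-finite vectors of $\ker\Omega''\subset I''(q,r,s)$ is the direct sum $H_0\oplus H_1$, where $H_0$ (respectively $H_1$) consists of those $K$-finite vectors that are even (respectively odd) functions of $y$. Each $H_l$ is an $\mathfrak{sl}_2$-module under the action of $\mathfrak{sl}_2$ on $I''(q,r,s)$ in which $\kappa$ acts by $i\partial_\theta$ and $\eta^\pm$ acts by $\tfrac12e^{\mp2i\theta}\bigl(-y\partial_y\mp i\partial_\theta-\tfrac12\pm y^2\bigr)$. A lowest (respectively, highest) weight submodule is a submodule generated by a nonzero weight vector annihilated by $\eta^-$ (respectively, $\eta^+$). *)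

theory Defs
  imports "HOL-Analysis.Analysis" "HOL-Library.Function_Algebras"
begin

text \<open>Points of the plane are pairs \<open>(\<theta>, y)\<close>.\<close>

type_synonym cfun = "real \<times> real \<Rightarrow> complex"

text \<open>Addition, subtraction and zero of functions are the pointwise ones of
  \<^theory>\<open>HOL-Library.Function_Algebras\<close>; complex scalars act as follows.\<close>

definition cscale :: "complex \<Rightarrow> cfun \<Rightarrow> cfun" where
  "cscale c F = (\<lambda>p. c * F p)"

interpretation cfun: vector_space cscale
  by unfold_locales (auto simp: cscale_def fun_eq_iff algebra_simps)


section \<open>Smooth functions and the differential operators\<close>

definition d_theta :: "cfun \<Rightarrow> cfun" where
  "d_theta F = (\<lambda>(\<theta>, y). vector_derivative (\<lambda>t. F (t, y)) (at \<theta>))"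

definition d_y :: "cfun \<Rightarrow> cfun" where
  "d_y F = (\<lambda>(\<theta>, y). vector_derivative (\<lambda>t. F (\<theta>, t)) (at y))"

primrec C_k :: "nat \<Rightarrow> cfun \<Rightarrow> bool" where
  "C_k 0 F \<longleftrightarrow> continuous_on UNIV F"
| "C_k (Suc k) F \<longleftrightarrow> (\<forall>p. F differentiable (at p)) \<and> C_k k (d_theta F) \<and> C_k k (d_y F)"

definition smooth :: "cfun \<Rightarrow> bool" where
  "smooth F \<longleftrightarrow> (\<forall>k. C_k k F)"

definition kappa_op :: "cfun \<Rightarrow> cfun" where
  "kappa_op F = (\<lambda>p. \<i> * d_theta F p)"

definition eta_plus_op :: "cfun \<Rightarrow> cfun" where
  "eta_plus_op F = (\<lambda>(\<theta>, y). 1/2 * exp (- 2 * \<i> * of_real \<theta>) *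
     (- of_real y * d_y F (\<theta>, y) - \<i> * d_theta F (\<theta>, y) - 1/2 * F (\<theta>, y)
      + of_real (y\<^sup>2) * F (\<theta>, y)))"

definition eta_minus_op :: "cfun \<Rightarrow> cfun" where
  "eta_minus_op F = (\<lambda>(\<theta>, y). 1/2 * exp (2 * \<i> * of_real \<theta>) *
     (- of_real y * d_y F (\<theta>, y) + \<i> * d_theta F (\<theta>, y) - 1/2 * F (\<theta>, y)
      - of_real (y\<^sup>2) * F (\<theta>, y)))"

definition Omega_op :: "cfun \<Rightarrow> cfun" where
  "Omega_op F = (\<lambda>(\<theta>, y). of_real (y\<^sup>2) *
     (2 * \<i> * d_theta F (\<theta>, y) - of_real (y\<^sup>2) * F (\<theta>, y) + d_y (d_y F) (\<theta>, y)))"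


section \<open>The Lie algebra and its modules\<close>

definition sl2 :: "(complex^2^2) set" where
  "sl2 = {X. trace X = 0}"

definition lie_bracket :: "complex^2^2 \<Rightarrow> complex^2^2 \<Rightarrow> complex^2^2" where
  "lie_bracket X Y = X ** Y - Y ** X"

definition sl2_h :: "complex^2^2" where
  "sl2_h = vector [vector [1, 0], vector [0, -1]]"

definition sl2_e_plus :: "complex^2^2" where
  "sl2_e_plus = vector [vector [0, 1], vector [0, 0]]"

definition sl2_e_minus :: "complex^2^2" where
  "sl2_e_minus = vector [vector [0, 0], vector [1, 0]]"

definition sl2_kappa :: "complex^2^2" where
  "sl2_kappa = map_matrix ((*) \<i>) (sl2_e_minus - sl2_e_plus)"

definition sl2_eta_plus :: "complex^2^2" where
  "sl2_eta_plus = map_matrix ((*) (1/2)) (sl2_h + map_matrix ((*) \<i>) (sl2_e_plus + sl2_e_minus))"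

definition sl2_eta_minus :: "complex^2^2" where
  "sl2_eta_minus = map_matrix ((*) (1/2)) (sl2_h - map_matrix ((*) \<i>) (sl2_e_plus + sl2_e_minus))"

text \<open>The action is the linear extension of the operators assigned to the basis
  \<open>\<kappa>, \<eta>\<^sup>+, \<eta>\<^sup>-\<close>. The coefficients of a traceless matrix in this basis come from
  \<open>h = \<eta>\<^sup>+ + \<eta>\<^sup>-\<close>, \<open>e\<^sup>+ + e\<^sup>- = -i(\<eta>\<^sup>+ - \<eta>\<^sup>-)\<close> and \<open>e\<^sup>- - e\<^sup>+ = -i\<kappa>\<close>;
  lemma \<open>sl2_basis_expansion\<close> below confirms them.\<close>

definition kappa_coord :: "complex^2^2 \<Rightarrow> complex" where
  "kappa_coord X = \<i> * (X $ 1 $ 2 - X $ 2 $ 1) / 2"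

definition eta_plus_coord :: "complex^2^2 \<Rightarrow> complex" where
  "eta_plus_coord X = X $ 1 $ 1 - \<i> * (X $ 1 $ 2 + X $ 2 $ 1) / 2"

definition eta_minus_coord :: "complex^2^2 \<Rightarrow> complex" where
  "eta_minus_coord X = X $ 1 $ 1 + \<i> * (X $ 1 $ 2 + X $ 2 $ 1) / 2"

definition sl2_act :: "complex^2^2 \<Rightarrow> cfun \<Rightarrow> cfun" where
  "sl2_act X F = cscale (kappa_coord X) (kappa_op F)
     + cscale (eta_plus_coord X) (eta_plus_op F)
     + cscale (eta_minus_coord X) (eta_minus_op F)"

lemmas sl2_basis_defs = sl2_h_def sl2_e_plus_def sl2_e_minus_def
  sl2_kappa_def sl2_eta_plus_def sl2_eta_minus_def

lemma sl2_basis_in_sl2: "sl2_kappa \<in> sl2" "sl2_eta_plus \<in> sl2" "sl2_eta_minus \<in> sl2"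
  by (simp_all add: sl2_def trace_def sum_2 sl2_basis_defs)

lemma sl2_basis_expansion:
  assumes "X \<in> sl2"
  shows "X = map_matrix ((*) (kappa_coord X)) sl2_kappa
     + map_matrix ((*) (eta_plus_coord X)) sl2_eta_plus
     + map_matrix ((*) (eta_minus_coord X)) sl2_eta_minus"
proof -
  have "X $ 2 $ 2 = - X $ 1 $ 1"
    using assms by (simp add: sl2_def trace_def sum_2 add_eq_0_iff)
  then show ?thesis
    by (simp add: vec_eq_iff forall_2 sl2_basis_defs kappa_coord_def eta_plus_coord_def
        eta_minus_coord_def field_simps)
qed

lemma sl2_act_kappa: "sl2_act sl2_kappa = kappa_op"
  and sl2_act_eta_plus: "sl2_act sl2_eta_plus = eta_plus_op"
  and sl2_act_eta_minus: "sl2_act sl2_eta_minus = eta_minus_op"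
  by (simp_all add: fun_eq_iff sl2_act_def cscale_def sl2_basis_defs kappa_coord_def
      eta_plus_coord_def eta_minus_coord_def)

definition sl2_module :: "cfun set \<Rightarrow> bool" where
  "sl2_module V \<longleftrightarrow> cfun.subspace V
     \<and> (\<forall>X\<in>sl2. \<forall>F\<in>V. sl2_act X F \<in> V)
     \<and> (\<forall>X\<in>sl2. \<forall>F\<in>V. \<forall>G\<in>V. sl2_act X (F + G) = sl2_act X F + sl2_act X G)
     \<and> (\<forall>X\<in>sl2. \<forall>F\<in>V. \<forall>c. sl2_act X (cscale c F) = cscale c (sl2_act X F))
     \<and> (\<forall>X\<in>sl2. \<forall>Y\<in>sl2. \<forall>F\<in>V. sl2_act (X + Y) F = sl2_act X F + sl2_act Y F)
     \<and> (\<forall>X\<in>sl2. \<forall>F\<in>V. \<forall>c. sl2_act (map_matrix ((*) c) X) F = cscale c (sl2_act X F))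
     \<and> (\<forall>X\<in>sl2. \<forall>Y\<in>sl2. \<forall>F\<in>V. sl2_act (lie_bracket X Y) F
           = sl2_act X (sl2_act Y F) - sl2_act Y (sl2_act X F))"

definition sl2_submodule :: "cfun set \<Rightarrow> cfun set \<Rightarrow> bool" where
  "sl2_submodule W V \<longleftrightarrow> sl2_module V \<and> W \<subseteq> V \<and> cfun.subspace W
     \<and> (\<forall>X\<in>sl2. \<forall>F\<in>W. sl2_act X F \<in> W)"

definition sl2_irreducible :: "cfun set \<Rightarrow> bool" where
  "sl2_irreducible V \<longleftrightarrow> sl2_module V \<and> V \<noteq> {0}
     \<and> (\<forall>W. sl2_submodule W V \<longrightarrow> W = {0} \<or> W = V)"

definition submodule_generated_by :: "cfun set \<Rightarrow> cfun \<Rightarrow> cfun set" where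
  "submodule_generated_by V v = \<Inter>{W. sl2_submodule W V \<and> v \<in> W}"

definition weight_vector :: "int \<Rightarrow> cfun \<Rightarrow> bool" where
  "weight_vector m F \<longleftrightarrow> F \<noteq> 0
     \<and> (\<exists>g. F = (\<lambda>(\<theta>, y). exp (- \<i> * of_int m * of_real \<theta> / 2) * g y))"

definition lowest_weight_submodule :: "cfun set \<Rightarrow> cfun set \<Rightarrow> bool" where
  "lowest_weight_submodule V W \<longleftrightarrow> sl2_submodule W V
     \<and> (\<exists>v\<in>V. (\<exists>m. weight_vector m v) \<and> sl2_act sl2_eta_minus v = 0
           \<and> W = submodule_generated_by V v)"

definition highest_weight_submodule :: "cfun set \<Rightarrow> cfun set \<Rightarrow> bool" where
  "highest_weight_submodule V W \<longleftrightarrow> sl2_submodule W V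
     \<and> (\<exists>v\<in>V. (\<exists>m. weight_vector m v) \<and> sl2_act sl2_eta_plus v = 0
           \<and> W = submodule_generated_by V v)"


section \<open>The induced representation and the solution spaces\<close>

text \<open>An element of \<open>\<int>\<^sub>4\<close> is given by an integer representative \<open>q\<close>; the factor
  \<open>i\<^sup>-\<^sup>j\<^sup>q\<close> depends only on its class. The parameters \<open>r = -1/2\<close> and \<open>s = i/2\<close> enter
  only through the operators.\<close>

definition I_cpt :: "int \<Rightarrow> cfun set" where
  "I_cpt q = {F. smooth F \<and>
     (\<forall>(j::int) \<theta> y. F (\<theta> + of_int j * pi, (-1) powi j * y) = \<i> powi (- j * q) * F (\<theta>, y))}"

definition K_finite :: "int \<Rightarrow> cfun \<Rightarrow> bool" where
  "K_finite q F \<longleftrightarrow> F \<in> cfun.span {G \<in> I_cpt q. \<exists>m. weight_vector m G}"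

definition Omega_ker :: "int \<Rightarrow> complex \<Rightarrow> cfun set" where
  "Omega_ker q lam = {F \<in> I_cpt q. Omega_op F = cscale (2 * lam) F}"

definition H_space :: "int \<Rightarrow> nat \<Rightarrow> cfun set" where
  "H_space q l = {F \<in> Omega_ker q (of_nat l * (of_nat l - 1) / 2). K_finite q F
     \<and> (l = 0 \<longrightarrow> (\<forall>\<theta> y. F (\<theta>, - y) = F (\<theta>, y)))
     \<and> (l = 1 \<longrightarrow> (\<forall>\<theta> y. F (\<theta>, - y) = - F (\<theta>, y)))}"

end

(* A weight vector e^(-i m theta/2) g(y) solves the eigenvalue equation iff
   g'' = (y^2 - m + l(l-1)/y^2) g. The solutions that are smooth at y = 0 and have the parity
   prescribed by the induced representation are the multiples of
   y^l e^(-y^2/2) M((2l+1-m)/4, l+1/2, y^2), with M the Kummer function, and they occur exactly for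
   m = q + 2l mod 4. So H_l has a basis of weight vectors v_m, one for each such m, and the
   contiguous relations of M give eta^+ v_m = -(2l+1+m)/4 v_(m+4) and
   eta^- v_m = -(2l+1-m)/4 v_(m-4). The coefficients vanish only at m = -(2l+1), respectively
   m = 2l+1; these are weights of H_l only for q = 3, respectively q = 1. *)

theory Submission
  imports Defs "HOL-Complex_Analysis.Complex_Analysis"
begin

section \<open>Calculus of smooth functions on the plane and weight components\<close>

text \<open>At y = 0 the radial equation has exponents l and 1 - l. For l >= 2 the second one is
  singular; for l <= 1 both solutions are smooth and only parity separates them, which is why H_0
  and H_1 are told apart by parity. No second solution is constructed: the Wronskian of an arbitrary
  admissible solution with the Kummer solution vanishes at 0, and this gives proportionality on each
  half-line. The singular point could still allow two different constants, c and -c in the case of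
  the wrong parity; the l-th derivative at 0 excludes this. The congruence for m follows, because
  equivariance under j = 1 gives a function of weight m the parity sign i^(m-q), to be compared with
  (-1)^l = i^(2l). A K-finite solution is a priori a sum of weight vectors that solves the equation
  only as a whole. The distinct eigenvalues of kappa split it into solutions, and the same argument
  splits the elements of a submodule. For q = 1 and q = 3 uniqueness holds because the kernel of
  eta^- (respectively eta^+) on H_l is a line.\<close>

lemma sum_fun_apply: "(\<Sum>i\<in>A. f i) x = (\<Sum>i\<in>A. f i x)"
  for f :: "'a \<Rightarrow> 'b \<Rightarrow> 'c::comm_monoid_add"
  by (induction A rule: infinite_finite_induct) auto

lemma smooth_imp_differentiable: "smooth F \<Longrightarrow> F differentiable (at p)"
  unfolding smooth_def by (metis C_k.simps(2))

lemma smooth_d_y: "smooth F \<Longrightarrow> smooth (d_y F)"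
  unfolding smooth_def by (metis C_k.simps(2))

lemma has_vector_derivative_d_theta:
  assumes "F differentiable (at (\<theta>, y))"
  shows "((\<lambda>t. F (t, y)) has_vector_derivative d_theta F (\<theta>, y)) (at \<theta>)"
proof -
  have "(\<lambda>t. (t, y)) differentiable (at \<theta>)"
    unfolding differentiable_def by (auto intro!: derivative_eq_intros exI)
  then have "(\<lambda>t. F (t, y)) differentiable (at \<theta>)"
    using differentiable_chain_at[of "\<lambda>t. (t, y)" \<theta> F] assms by (simp add: o_def)
  then show ?thesis
    by (simp add: d_theta_def vector_derivative_works)
qed

lemma has_vector_derivative_d_y:
  assumes "F differentiable (at (\<theta>, y))"
  shows "((\<lambda>t. F (\<theta>, t)) has_vector_derivative d_y F (\<theta>, y)) (at y)"
proof -
  have "(\<lambda>t. (\<theta>, t)) differentiable (at y)"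
    unfolding differentiable_def by (auto intro!: derivative_eq_intros exI)
  then have "(\<lambda>t. F (\<theta>, t)) differentiable (at y)"
    using differentiable_chain_at[of "\<lambda>t. (\<theta>, t)" y F] assms by (simp add: o_def)
  then show ?thesis
    by (simp add: d_y_def vector_derivative_works)
qed

lemma d_theta_add:
  assumes "\<And>p. F differentiable (at p)" "\<And>p. G differentiable (at p)"
  shows "d_theta (F + G) = d_theta F + d_theta G"
proof
  fix p :: "real \<times> real"
  obtain \<theta> y where p: "p = (\<theta>, y)" by force
  have "((\<lambda>t. F (t, y) + G (t, y)) has_vector_derivative d_theta F (\<theta>, y) + d_theta G (\<theta>, y)) (at \<theta>)"
    by (intro has_vector_derivative_add has_vector_derivative_d_theta assms)
  from vector_derivative_at[OF this] show "d_theta (F + G) p = (d_theta F + d_theta G) p"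
    by (simp add: p d_theta_def)
qed

lemma d_y_add:
  assumes "\<And>p. F differentiable (at p)" "\<And>p. G differentiable (at p)"
  shows "d_y (F + G) = d_y F + d_y G"
proof
  fix p :: "real \<times> real"
  obtain \<theta> y where p: "p = (\<theta>, y)" by force
  have "((\<lambda>t. F (\<theta>, t) + G (\<theta>, t)) has_vector_derivative d_y F (\<theta>, y) + d_y G (\<theta>, y)) (at y)"
    by (intro has_vector_derivative_add has_vector_derivative_d_y assms)
  from vector_derivative_at[OF this] show "d_y (F + G) p = (d_y F + d_y G) p"
    by (simp add: p d_y_def)
qed

lemma d_theta_cscale:
  assumes "\<And>p. F differentiable (at p)"
  shows "d_theta (cscale c F) = cscale c (d_theta F)"
proof
  fix p :: "real \<times> real"
  obtain \<theta> y where p: "p = (\<theta>, y)" by force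
  have "((\<lambda>t. c * F (t, y)) has_vector_derivative c * d_theta F (\<theta>, y)) (at \<theta>)"
    by (intro has_vector_derivative_mult_right has_vector_derivative_d_theta assms)
  from vector_derivative_at[OF this] show "d_theta (cscale c F) p = cscale c (d_theta F) p"
    by (simp add: p d_theta_def cscale_def)
qed

lemma d_y_cscale:
  assumes "\<And>p. F differentiable (at p)"
  shows "d_y (cscale c F) = cscale c (d_y F)"
proof
  fix p :: "real \<times> real"
  obtain \<theta> y where p: "p = (\<theta>, y)" by force
  have "((\<lambda>t. c * F (\<theta>, t)) has_vector_derivative c * d_y F (\<theta>, y)) (at y)"
    by (intro has_vector_derivative_mult_right has_vector_derivative_d_y assms)
  from vector_derivative_at[OF this] show "d_y (cscale c F) p = cscale c (d_y F) p"
    by (simp add: p d_y_def cscale_def)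
qed

lemma C_k_add: "C_k k F \<Longrightarrow> C_k k G \<Longrightarrow> C_k k (F + G)"
proof (induction k arbitrary: F G)
  case 0
  then show ?case by (auto simp: plus_fun_def intro: continuous_on_add)
next
  case (Suc k)
  moreover have "F + G differentiable (at p)" for p
    using Suc.prems unfolding plus_fun_def by (intro differentiable_add) (auto simp del: split_paired_All)
  moreover have "d_theta (F + G) = d_theta F + d_theta G" "d_y (F + G) = d_y F + d_y G"
    using Suc.prems by (auto intro!: d_theta_add d_y_add simp del: split_paired_All)
  ultimately show ?case
    by (simp only: C_k.simps) simp
qed

lemma C_k_cscale: "C_k k F \<Longrightarrow> C_k k (cscale c F)"
proof (induction k arbitrary: F)
  case 0
  then show ?case by (auto simp: cscale_def intro: continuous_intros)
next
  case (Suc k)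
  moreover have "cscale c F differentiable (at p)" for p
    using Suc.prems unfolding cscale_def by (intro differentiable_mult) (auto simp del: split_paired_All)
  ultimately show ?case
    by (simp add: d_theta_cscale d_y_cscale del: split_paired_All)
qed

lemma smooth_add: "smooth F \<Longrightarrow> smooth G \<Longrightarrow> smooth (F + G)"
  by (simp add: smooth_def C_k_add)

lemma smooth_cscale: "smooth F \<Longrightarrow> smooth (cscale c F)"
  by (simp add: smooth_def C_k_cscale)

text \<open>Products of an entire function of theta and an entire function of y form a class closed
  under both partial derivatives, which is what the recursion in \<open>C_k\<close> asks
  for.\<close>

lemma C_k_entire_product:
  assumes "E holomorphic_on UNIV" "G holomorphic_on UNIV"
  shows "C_k k (\<lambda>(\<theta>, y). E (of_real \<theta>) * G (of_real y))"
  using assms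
proof (induction k arbitrary: E G)
  case 0
  have "continuous_on UNIV E" "continuous_on UNIV G"
    using 0 by (auto intro: holomorphic_on_imp_continuous_on)
  then have "continuous_on UNIV (\<lambda>p::real \<times> real. E (of_real (fst p)) * G (of_real (snd p)))"
    by (auto intro!: continuous_intros intro: continuous_on_compose2)
  then show ?case
    by (simp add: case_prod_unfold)
next
  case (Suc k)
  have DE: "(E has_field_derivative deriv E z) (at z)" and DG: "(G has_field_derivative deriv G z) (at z)" for z
    using Suc.prems holomorphic_derivI[of _ UNIV] by auto
  have hol: "deriv E holomorphic_on UNIV" "deriv G holomorphic_on UNIV"
    using Suc.prems holomorphic_deriv by auto
  have vE: "((\<lambda>t. E (of_real t)) has_vector_derivative deriv E (of_real t)) (at t)" for t
    using has_vector_derivative_real_field[OF DE] .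
  have vG: "((\<lambda>t. G (of_real t)) has_vector_derivative deriv G (of_real t)) (at t)" for t
    using has_vector_derivative_real_field[OF DG] .
  have dt: "d_theta (\<lambda>(\<theta>, y). E (of_real \<theta>) * G (of_real y)) = (\<lambda>(\<theta>, y). deriv E (of_real \<theta>) * G (of_real y))"
    unfolding d_theta_def
    by (auto simp: fun_eq_iff intro!: vector_derivative_at has_vector_derivative_mult_left vE)
  have dy: "d_y (\<lambda>(\<theta>, y). E (of_real \<theta>) * G (of_real y)) = (\<lambda>(\<theta>, y). E (of_real \<theta>) * deriv G (of_real y))"
    unfolding d_y_def
    by (auto simp: fun_eq_iff intro!: vector_derivative_at has_vector_derivative_mult_right vG)
  have "(\<lambda>p::real \<times> real. E (of_real (fst p)) * G (of_real (snd p))) differentiable (at p)" for p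
  proof -
    have "(\<lambda>p::real \<times> real. E (of_real (fst p))) differentiable (at p)"
      using differentiable_chain_at[of fst p "\<lambda>t. E (of_real t)"] vE
      by (auto simp: o_def bounded_linear_fst bounded_linear_imp_differentiable intro: differentiableI_vector)
    moreover have "(\<lambda>p::real \<times> real. G (of_real (snd p))) differentiable (at p)"
      using differentiable_chain_at[of snd p "\<lambda>t. G (of_real t)"] vG
      by (auto simp: o_def bounded_linear_snd bounded_linear_imp_differentiable intro: differentiableI_vector)
    ultimately show ?thesis by (rule differentiable_mult)
  qed
  then have "(\<lambda>(\<theta>, y). E (of_real \<theta>) * G (of_real y)) differentiable (at p)" for p :: "real \<times> real"
    by (simp add: case_prod_unfold)
  then show ?case
    using Suc.IH Suc.prems hol by (simp only: C_k.simps dt dy) simp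
qed

lemma smooth_entire_product:
  assumes "E holomorphic_on UNIV" "G holomorphic_on UNIV"
  shows "smooth (\<lambda>(\<theta>, y). E (of_real \<theta>) * G (of_real y))"
  using C_k_entire_product[OF assms] by (simp add: smooth_def)

section \<open>The induced space and the linearity of the operators on smooth functions\<close>

lemma I_cpt_subspace: "cfun.subspace (I_cpt q)"
proof (rule cfun.subspaceI)
  have "smooth 0"
    using smooth_entire_product[of "\<lambda>_. 0" "\<lambda>_. 0"] by (simp add: zero_fun_def case_prod_unfold)
  then show "0 \<in> I_cpt q"
    by (auto simp: I_cpt_def)
qed (auto simp: I_cpt_def smooth_add smooth_cscale cscale_def[of _ _] algebra_simps intro: smooth_cscale[unfolded cscale_def])

lemma kappa_op_add: "smooth F \<Longrightarrow> smooth G \<Longrightarrow> kappa_op (F + G) = kappa_op F + kappa_op G"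
  and eta_plus_op_add: "smooth F \<Longrightarrow> smooth G \<Longrightarrow> eta_plus_op (F + G) = eta_plus_op F + eta_plus_op G"
  and eta_minus_op_add: "smooth F \<Longrightarrow> smooth G \<Longrightarrow> eta_minus_op (F + G) = eta_minus_op F + eta_minus_op G"
  and Omega_op_add: "smooth F \<Longrightarrow> smooth G \<Longrightarrow> Omega_op (F + G) = Omega_op F + Omega_op G"
  by (simp_all add: kappa_op_def eta_plus_op_def eta_minus_op_def Omega_op_def fun_eq_iff
      d_theta_add d_y_add smooth_imp_differentiable smooth_d_y algebra_simps)

lemma kappa_op_cscale: "smooth F \<Longrightarrow> kappa_op (cscale c F) = cscale c (kappa_op F)"
  and eta_plus_op_cscale: "smooth F \<Longrightarrow> eta_plus_op (cscale c F) = cscale c (eta_plus_op F)"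
  and eta_minus_op_cscale: "smooth F \<Longrightarrow> eta_minus_op (cscale c F) = cscale c (eta_minus_op F)"
  and Omega_op_cscale: "smooth F \<Longrightarrow> Omega_op (cscale c F) = cscale c (Omega_op F)"
  by (simp_all add: kappa_op_def eta_plus_op_def eta_minus_op_def Omega_op_def fun_eq_iff
      d_theta_cscale d_y_cscale smooth_imp_differentiable smooth_d_y)
     (simp_all add: cscale_def algebra_simps)

lemma sl2_act_add: "smooth F \<Longrightarrow> smooth G \<Longrightarrow> sl2_act X (F + G) = sl2_act X F + sl2_act X G"
  by (simp add: sl2_act_def kappa_op_add eta_plus_op_add eta_minus_op_add cfun.scale_right_distrib)

lemma sl2_act_cscale: "smooth F \<Longrightarrow> sl2_act X (cscale c F) = cscale c (sl2_act X F)"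
  by (simp add: sl2_act_def kappa_op_cscale eta_plus_op_cscale eta_minus_op_cscale
      cfun.scale_right_distrib mult.commute)

text \<open>In contrast to \<open>weight_vector\<close>, the profile \<open>g\<close> may vanish, so
  the functions of a fixed weight are closed under linear combinations and a decomposition can be
  padded with zero components.\<close>

definition wt :: "int \<Rightarrow> (real \<Rightarrow> complex) \<Rightarrow> cfun" where
  "wt m g = (\<lambda>(\<theta>, y). exp (- \<i> * of_int m * of_real \<theta> / 2) * g y)"

lemma wt_0_left [simp]: "wt m g (0, y) = g y"
  by (simp add: wt_def)

lemma wt_add: "wt m (\<lambda>y. f y + g y) = wt m f + wt m g"
  and wt_cmult: "wt m (\<lambda>y. c * g y) = cscale c (wt m g)"
  and wt_zero: "wt m (\<lambda>_. 0) = 0"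
  by (auto simp: wt_def fun_eq_iff cscale_def algebra_simps)

lemma wt_eq_0_iff: "wt m g = 0 \<longleftrightarrow> (\<forall>y. g y = 0)"
  by (auto simp: wt_def fun_eq_iff)

lemma weight_vector_wt: "weight_vector m F \<longleftrightarrow> F \<noteq> 0 \<and> (\<exists>g. F = wt m g)"
  by (simp add: weight_vector_def wt_def)

text \<open>The sum is differentiated in theta alone, with y fixed, so \<open>g\<close> enters only
  through constants and may be an arbitrary function of y.\<close>

lemma kappa_op_sum_wt:
  "kappa_op (\<Sum>m\<in>M. wt m (g m)) = (\<Sum>m\<in>M. cscale (of_int m / 2) (wt m (g m)))"
proof
  fix p :: "real \<times> real"
  obtain \<theta> y where p: "p = (\<theta>, y)" by force
  have "((\<lambda>t. \<Sum>m\<in>M. wt m (g m) (t, y)) has_vector_derivative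
      (\<Sum>m\<in>M. (- \<i> * of_int m / 2) * wt m (g m) (\<theta>, y))) (at \<theta>)"
  proof (rule has_vector_derivative_sum)
    fix m
    have "((\<lambda>z. exp (- \<i> * of_int m * z / 2) * g m y) has_field_derivative
        (- \<i> * of_int m / 2) * (exp (- \<i> * of_int m * of_real \<theta> / 2) * g m y)) (at (of_real \<theta>))"
      by (auto intro!: derivative_eq_intros)
    from has_vector_derivative_real_field[OF this]
    show "((\<lambda>t. wt m (g m) (t, y)) has_vector_derivative
        (- \<i> * of_int m / 2) * wt m (g m) (\<theta>, y)) (at \<theta>)"
      by (simp add: wt_def)
  qed
  from vector_derivative_at[OF this]
  show "kappa_op (\<Sum>m\<in>M. wt m (g m)) p = (\<Sum>m\<in>M. cscale (of_int m / 2) (wt m (g m))) p"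
    by (simp add: p kappa_op_def d_theta_def sum_fun_apply sum_distrib_left cscale_def)
       (intro sum.cong refl, simp add: algebra_simps flip: mult.assoc)
qed

lemma kappa_op_wt: "kappa_op (wt m g) = cscale (of_int m / 2) (wt m g)"
  using kappa_op_sum_wt[of "\<lambda>_. g" "{m}"] by simp

lemma d_theta_wt: "d_theta (wt m g) p = - \<i> * of_int m / 2 * wt m g p"
proof -
  have "\<i> * d_theta (wt m g) p = of_int m / 2 * wt m g p"
    using fun_cong[OF kappa_op_wt[of m g], of p] by (simp add: kappa_op_def cscale_def)
  then have "- \<i> * (\<i> * d_theta (wt m g) p) = - \<i> * (of_int m / 2 * wt m g p)"
    by (rule arg_cong)
  then show ?thesis by (simp add: field_simps flip: mult.assoc)
qed

lemma d_y_wt: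
  assumes "\<And>y. (g has_vector_derivative g' y) (at y)"
  shows "d_y (wt m g) = wt m g'"
  unfolding d_y_def wt_def
  by (auto simp: fun_eq_iff intro!: vector_derivative_at has_vector_derivative_mult_right assms)

text \<open>No regularity in \<open>y\<close> is assumed of the components, so that the choice \<open>W = {0}\<close>
  also gives the linear independence of the exponentials.\<close>

lemma weight_components_in_subspace:
  assumes W: "cfun.subspace W" and kap: "\<And>F. F \<in> W \<Longrightarrow> kappa_op F \<in> W"
    and "finite M" "(\<Sum>m\<in>M. wt m (g m)) \<in> W" "n \<in> M"
  shows "wt n (g n) \<in> W"
  using assms(3-)
proof (induction M arbitrary: g n rule: finite_induct)
  case empty
  then show ?case by simp
next
  case (insert k M)
  let ?F = "\<Sum>m\<in>insert k M. wt m (g m)"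
  have scal: "cscale c F \<in> W" if "F \<in> W" for c F
    using W that by (simp add: cfun.subspace_scale)
  \<comment> \<open>\<open>kappa - k/2\<close> kills the component of weight \<open>k\<close> and
    multiplies the one of weight \<open>m\<close> by \<open>(m - k)/2\<close>, which is nonzero on
    \<open>M\<close>; this leaves a sum over \<open>M\<close> for the induction hypothesis.\<close>
  have "kappa_op ?F - cscale (of_int k / 2) ?F \<in> W"
    using W insert.prems kap scal by (intro cfun.subspace_diff) auto
  also have "kappa_op ?F - cscale (of_int k / 2) ?F = (\<Sum>m\<in>M. wt m (\<lambda>y. (of_int m - of_int k) / 2 * g m y))"
    unfolding kappa_op_sum_wt using insert.hyps
    by (simp add: wt_cmult cfun.scale_sum_right cfun.scale_right_distrib del: times_divide_eq_left
        flip: sum_subtractf cfun.scale_left_diff_distrib diff_divide_distrib)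
  finally have IH: "wt m (\<lambda>y. (of_int m - of_int k) / 2 * g m y) \<in> W" if "m \<in> M" for m
    using insert.IH[of "\<lambda>m y. (of_int m - of_int k) / 2 * g m y"] that by blast
  have M: "wt m (g m) \<in> W" if "m \<in> M" for m
  proof -
    have "of_int m - (of_int k :: complex) \<noteq> 0"
      using insert.hyps that by auto
    then have "2 / (of_int m - of_int k) * ((of_int m - of_int k) / 2) = (1 :: complex)"
      by simp
    moreover have "cscale (2 / (of_int m - of_int k)) (cscale ((of_int m - of_int k) / 2) (wt m (g m))) \<in> W"
      using scal[OF IH[OF that]] unfolding wt_cmult .
    ultimately show ?thesis by (simp only: cfun.scale_scale cfun.scale_one)
  qed
  have "wt k (g k) = ?F - (\<Sum>m\<in>M. wt m (g m))"
    using insert.hyps by simp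
  moreover have "?F - (\<Sum>m\<in>M. wt m (g m)) \<in> W"
    by (rule cfun.subspace_diff[OF W insert.prems(1) cfun.subspace_sum[OF W M]])
  ultimately have "wt k (g k) \<in> W"
    by simp
  then show ?case
    using M insert.prems by auto
qed

lemma sum_wt_eq_0:
  assumes "finite M" "(\<Sum>m\<in>M. wt m (g m)) = 0" "n \<in> M"
  shows "g n y = 0"
proof -
  have "wt n (g n) \<in> {0}"
    \<comment> \<open>The instance of \<open>kappa_op_wt\<close> says \<open>kappa_op 0 = 0\<close>,
      that is, \<open>{0}\<close> is stable.\<close>
    using assms kappa_op_wt[of 0 "\<lambda>_. 0"] by (intro weight_components_in_subspace) (auto simp: wt_zero)
  then show ?thesis by (simp add: wt_eq_0_iff)
qed


section \<open>Kummer functions and the radial equation\<close>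

text \<open>The confluent hypergeometric series M(a, b, .) as a formal power series: its contiguous
  relations and its differential equation become identities between coefficients, and are evaluated
  afterwards.\<close>

definition kummer :: "complex \<Rightarrow> complex \<Rightarrow> complex fps" where
  "kummer a b = Abs_fps (\<lambda>k. pochhammer a k / (pochhammer b k * fact k))"

lemma kummer_nth_Suc:
  "kummer a b $ Suc k = (a + of_nat k) / ((b + of_nat k) * of_nat (Suc k)) * (kummer a b $ k)"
  by (simp add: kummer_def pochhammer_Suc mult_ac)

lemma fps_conv_radius_kummer:
  assumes "Re b > 0"
  shows "fps_conv_radius (kummer a b) = \<infinity>"
  unfolding fps_conv_radius_def
proof (rule conv_radius_inftyI'')
  fix z :: complex
  \<comment> \<open>\<open>C * (n + 1)\<close> bounds \<open>|a + n| |z|\<close>, and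
    \<open>n >= N\<close> gives \<open>C <= n/2 <= |b + n| / 2\<close>, so the quotient of
    consecutive terms is at most 1/2.\<close>
  define C where "C = (norm a + 1) * norm z"
  obtain N :: nat where N: "2 * C \<le> N"
    using real_arch_simple by blast
  show "summable (\<lambda>n. kummer a b $ n * z ^ n)"
  proof (rule summable_ratio_test)
    fix n assume n: "n \<ge> N"
    have "norm (a + of_nat n) \<le> norm a + n"
      by (metis norm_of_nat norm_triangle_ineq)
    also have "\<dots> \<le> (norm a + 1) * Suc n"
      using norm_ge_zero[of a] by (simp add: algebra_simps)
    finally have "norm (a + of_nat n) * norm z \<le> C * Suc n"
      unfolding C_def using mult_right_mono[OF _ norm_ge_zero[of z]] by (fastforce simp: mult_ac)
    also have "\<dots> \<le> (1/2 * norm (b + of_nat n)) * Suc n"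
    proof (rule mult_right_mono)
      have "C \<le> 1/2 * n" using N n by linarith
      also have "\<dots> \<le> 1/2 * Re (b + of_nat n)" using assms by simp
      also have "\<dots> \<le> 1/2 * norm (b + of_nat n)" using complex_Re_le_cmod[of "b + of_nat n"] by linarith
      finally show "C \<le> 1/2 * norm (b + of_nat n)" .
    qed simp
    finally have le: "norm (a + of_nat n) * norm z \<le> 1/2 * (norm (b + of_nat n) * Suc n)"
      by simp
    have "b + of_nat n \<noteq> 0"
      using assms by (auto simp: complex_eq_iff)
    then have "norm (a + of_nat n) / (norm (b + of_nat n) * Suc n) * norm z \<le> 1/2"
      using le by (simp add: field_simps del: of_nat_Suc)
    from mult_right_mono[OF this, of "norm (kummer a b $ n * z ^ n)"]
    show "norm (kummer a b $ Suc n * z ^ Suc n) \<le> 1/2 * norm (kummer a b $ n * z ^ n)"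
      by (simp add: kummer_nth_Suc norm_mult norm_divide norm_power mult_ac del: of_nat_Suc)
  qed simp
qed

lemma kummer_nonzero_denom: "Re b > 0 \<Longrightarrow> b + of_nat n \<noteq> 0" "Re b > 0 \<Longrightarrow> pochhammer b n \<noteq> 0"
proof -
  show 1: "b + of_nat n \<noteq> 0" if "Re b > 0" for n
    using that by (auto simp: complex_eq_iff)
  show "pochhammer b n \<noteq> 0" if "Re b > 0"
  proof
    assume "pochhammer b n = 0"
    then obtain k where "b = - of_nat k" by (auto simp: pochhammer_eq_0_iff)
    then have "b + of_nat k = 0" by simp
    with 1[OF that] show False by blast
  qed
qed

text \<open>The Euler operator multiplies the n-th coefficient by n, so the claim is
  \<open>(a + n) (a)_n = a (a + 1)_n\<close> for rising factorials.\<close>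

lemma kummer_raise_fps:
  "fps_X * fps_deriv (kummer a b) + fps_const a * kummer a b = fps_const a * kummer (a + 1) b"
proof (rule fps_ext)
  fix n
  have "a * pochhammer (a + 1) n = (a + of_nat n) * pochhammer a n"
    by (metis mult.commute pochhammer_Suc pochhammer_rec)
  then show "(fps_X * fps_deriv (kummer a b) + fps_const a * kummer a b) $ n
      = (fps_const a * kummer (a + 1) b) $ n"
    by (cases n) (simp_all add: kummer_def add_divide_distrib[symmetric] algebra_simps)
qed

lemma kummer_lower_fps:
  assumes "Re b > 0"
  shows "fps_X * fps_deriv (kummer a b) + fps_const (b - a) * kummer a b - fps_X * kummer a b
    = fps_const (b - a) * kummer (a - 1) b"
proof (rule fps_ext)
  fix n
  show "(fps_X * fps_deriv (kummer a b) + fps_const (b - a) * kummer a b - fps_X * kummer a b) $ n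
      = (fps_const (b - a) * kummer (a - 1) b) $ n"
  proof (cases n)
    case 0
    then show ?thesis by (simp add: kummer_def)
  next
    case (Suc k)
    \<comment> \<open>This exposes the common factor \<open>pochhammer a k\<close>; what remains is
      \<open>(k + 1 + b - a) (a + k) - (b + k) (k + 1) = (b - a) (a - 1)\<close>.\<close>
    have 1: "pochhammer (a - 1) (Suc k) = (a - 1) * pochhammer a k"
      by (simp add: pochhammer_rec)
    have "(1 + of_nat k) \<noteq> (0::complex)"
      by (metis of_nat_Suc of_nat_eq_0_iff nat.distinct(1))
    moreover note kummer_nonzero_denom[OF assms, of k]
    ultimately show ?thesis
      unfolding Suc using 1 by (simp add: kummer_def pochhammer_Suc divide_simps) (simp add: algebra_simps)
  qed
qed

text \<open>In degree n Kummer's equation is the two-term recursion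
  \<open>(b + n) (n + 1) c_(n+1) = (a + n) c_n\<close>.\<close>

lemma kummer_ode_fps:
  assumes "Re b > 0"
  shows "fps_X * fps_deriv (fps_deriv (kummer a b)) + fps_const b * fps_deriv (kummer a b)
    - fps_X * fps_deriv (kummer a b) - fps_const a * kummer a b = 0"
proof (rule fps_ext)
  fix n
  have nz: "(1 + of_nat n) \<noteq> (0::complex)"
    by (metis of_nat_Suc of_nat_eq_0_iff nat.distinct(1))
  have "(b + of_nat n) * (1 + of_nat n) * (kummer a b $ Suc n) = (a + of_nat n) * (kummer a b $ n)"
    using nz kummer_nonzero_denom[OF assms, of n] by (simp add: kummer_nth_Suc)
  then show "(fps_X * fps_deriv (fps_deriv (kummer a b)) + fps_const b * fps_deriv (kummer a b)
    - fps_X * fps_deriv (kummer a b) - fps_const a * kummer a b) $ n = 0 $ n"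
    by (cases n) (simp_all add: algebra_simps)
qed

context
  fixes a b :: complex
  assumes b: "Re b > 0"
begin

lemma fps_conv_radius_kummer_derivs:
  "fps_conv_radius (fps_deriv (kummer a b)) = \<infinity>"
  "fps_conv_radius (fps_deriv (fps_deriv (kummer a b))) = \<infinity>"
proof -
  show 1: "fps_conv_radius (fps_deriv (kummer a b)) = \<infinity>"
    using fps_conv_radius_deriv[of "kummer a b"] fps_conv_radius_kummer[OF b, of a] by simp
  show "fps_conv_radius (fps_deriv (fps_deriv (kummer a b))) = \<infinity>"
    using fps_conv_radius_deriv[of "fps_deriv (kummer a b)"] 1 by simp
qed

lemma eval_kummer_derivs:
  "(eval_fps (kummer a b) has_field_derivative eval_fps (fps_deriv (kummer a b)) z) (at z)"
  "(eval_fps (fps_deriv (kummer a b)) has_field_derivative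
     eval_fps (fps_deriv (fps_deriv (kummer a b))) z) (at z)"
  by (auto intro!: has_field_derivative_eval_fps simp: fps_conv_radius_kummer_derivs fps_conv_radius_kummer[OF b])

text \<open>Evaluation respects sums and products inside the discs of convergence; these radii
  discharge that condition in the three evaluated identities that follow.\<close>

lemma kummer_conv_radii:
  "fps_conv_radius (fps_X * fps_deriv (kummer a b)) = \<infinity>"
  "fps_conv_radius (fps_X * kummer a b) = \<infinity>"
  "fps_conv_radius (fps_X * fps_deriv (fps_deriv (kummer a b))) = \<infinity>"
  "fps_conv_radius (fps_const c * kummer a b) = \<infinity>"
  "fps_conv_radius (fps_const c * fps_deriv (kummer a b)) = \<infinity>"
  using fps_conv_radius_mult[of fps_X "fps_deriv (kummer a b)"]
    fps_conv_radius_mult[of fps_X "kummer a b"]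
    fps_conv_radius_mult[of fps_X "fps_deriv (fps_deriv (kummer a b))"]
    fps_conv_radius_mult[of "fps_const c" "kummer a b"]
    fps_conv_radius_mult[of "fps_const c" "fps_deriv (kummer a b)"]
  by (simp_all add: fps_conv_radius_kummer_derivs fps_conv_radius_kummer[OF b])

lemma kummer_raise:
  "z * eval_fps (fps_deriv (kummer a b)) z + a * eval_fps (kummer a b) z = a * eval_fps (kummer (a + 1) b) z"
  using arg_cong[OF kummer_raise_fps, of "\<lambda>f. eval_fps f z" a b]
  by (simp add: eval_fps_add eval_fps_mult fps_conv_radius_kummer_derivs kummer_conv_radii
      fps_conv_radius_kummer[OF b])

lemma kummer_lower:
  "z * eval_fps (fps_deriv (kummer a b)) z + (b - a - z) * eval_fps (kummer a b) z
     = (b - a) * eval_fps (kummer (a - 1) b) z"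
proof -
  have R: "fps_conv_radius (fps_X * fps_deriv (kummer a b) + fps_const (b - a) * kummer a b) = \<infinity>"
    using fps_conv_radius_add[of "fps_X * fps_deriv (kummer a b)" "fps_const (b - a) * kummer a b"]
    by (simp add: kummer_conv_radii)
  show ?thesis
    using arg_cong[OF kummer_lower_fps[OF b], of "\<lambda>f. eval_fps f z" a]
    by (simp add: eval_fps_add eval_fps_diff eval_fps_mult fps_conv_radius_kummer_derivs kummer_conv_radii
      fps_conv_radius_kummer[OF b] R left_diff_distrib right_diff_distrib distrib_right del: fps_const_sub)
      (simp add: algebra_simps)
qed

lemma kummer_ode:
  "z * eval_fps (fps_deriv (fps_deriv (kummer a b))) z + (b - z) * eval_fps (fps_deriv (kummer a b)) z
     - a * eval_fps (kummer a b) z = 0"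
proof -
  let ?f = "fps_X * fps_deriv (fps_deriv (kummer a b)) + fps_const b * fps_deriv (kummer a b)"
  have R1: "fps_conv_radius ?f = \<infinity>"
    using fps_conv_radius_add[of "fps_X * fps_deriv (fps_deriv (kummer a b))" "fps_const b * fps_deriv (kummer a b)"]
    by (simp add: kummer_conv_radii)
  have R2: "fps_conv_radius (?f - fps_X * fps_deriv (kummer a b)) = \<infinity>"
    using fps_conv_radius_diff[of ?f "fps_X * fps_deriv (kummer a b)"] R1
    by (simp add: kummer_conv_radii)
  show ?thesis
    using arg_cong[OF kummer_ode_fps[OF b], of "\<lambda>f. eval_fps f z" a]
    by (simp add: eval_fps_add eval_fps_diff eval_fps_mult fps_conv_radius_kummer_derivs kummer_conv_radii
      fps_conv_radius_kummer[OF b] R1 R2 left_diff_distrib)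
      (simp add: algebra_simps)
qed

end

text \<open>Taken on the whole complex plane although only real arguments enter the weight vectors:
  being entire, it has derivatives of every order and yields smooth functions on the plane.\<close>

definition weight_fun :: "nat \<Rightarrow> int \<Rightarrow> complex \<Rightarrow> complex" where
  "weight_fun l m z = z ^ l * exp (- z\<^sup>2 / 2) *
     eval_fps (kummer ((2 * of_nat l + 1 - of_int m) / 4) (of_nat l + 1 / 2)) (z\<^sup>2)"

text \<open>The extra factor z turns \<open>z ^ (l - 1)\<close> back into \<open>z ^ l\<close>, so l
  = 0 needs no separate formula, and the result has the same shape with a new Q. It can therefore be
  iterated, as the second-order equation requires.\<close>

lemma deriv_power_gauss_mult:
  assumes "(Q has_field_derivative Q') (at z)"
  shows "z * deriv (\<lambda>z. z ^ l * exp (- z\<^sup>2 / 2) * Q z) z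
     = z ^ l * exp (- z\<^sup>2 / 2) * ((of_nat l - z\<^sup>2) * Q z + z * Q')"
proof -
  have "((\<lambda>z. z ^ l * exp (- z\<^sup>2 / 2) * Q z) has_field_derivative
      (of_nat l * z ^ (l - 1)) * exp (- z\<^sup>2 / 2) * Q z - z * z ^ l * exp (- z\<^sup>2 / 2) * Q z
        + z ^ l * exp (- z\<^sup>2 / 2) * Q') (at z)"
    by (auto intro!: derivative_eq_intros assms simp: algebra_simps)
  note D = DERIV_imp_deriv[OF this]
  have "z * deriv (\<lambda>z. z ^ l * exp (- z\<^sup>2 / 2) * Q z) z
      = (z * (of_nat l * z ^ (l - 1))) * exp (- z\<^sup>2 / 2) * Q z - z\<^sup>2 * z ^ l * exp (- z\<^sup>2 / 2) * Q z
        + z * z ^ l * exp (- z\<^sup>2 / 2) * Q'"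
    unfolding D by (simp add: algebra_simps power2_eq_square)
  also have "z * (of_nat l * z ^ (l - 1)) = of_nat l * z ^ l"
    by (cases l) simp_all
  finally show ?thesis
    by (simp add: algebra_simps)
qed

section \<open>Ladder relations, differential equation and behaviour at 0 of the radial
  functions\<close>

context
  fixes l :: nat and m :: int
begin

private abbreviation (input) "a0 \<equiv> ((2 * of_nat l + 1 - of_int m) / 4 :: complex)"
private abbreviation (input) "b0 \<equiv> (of_nat l + 1 / 2 :: complex)"
private abbreviation (input) "K0 \<equiv> eval_fps (kummer a0 b0)"
private abbreviation (input) "K1 \<equiv> eval_fps (fps_deriv (kummer a0 b0))"
private abbreviation (input) "K2 \<equiv> eval_fps (fps_deriv (fps_deriv (kummer a0 b0)))"

lemma K0_square_deriv: "((\<lambda>z. K0 (z\<^sup>2)) has_field_derivative 2 * z * K1 (z\<^sup>2)) (at z)"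
  and K1_square_deriv: "((\<lambda>z. K1 (z\<^sup>2)) has_field_derivative 2 * z * K2 (z\<^sup>2)) (at z)"
proof -
  have b: "Re b0 > 0" and sq: "((\<lambda>z. z\<^sup>2) has_field_derivative 2 * z) (at z)"
    by (auto intro!: derivative_eq_intros)
  show "((\<lambda>z. K0 (z\<^sup>2)) has_field_derivative 2 * z * K1 (z\<^sup>2)) (at z)"
    using DERIV_chain2[OF eval_kummer_derivs(1)[OF b] sq] by (simp add: mult_ac)
  show "((\<lambda>z. K1 (z\<^sup>2)) has_field_derivative 2 * z * K2 (z\<^sup>2)) (at z)"
    using DERIV_chain2[OF eval_kummer_derivs(2)[OF b] sq] by (simp add: mult_ac)
qed

lemma weight_fun_holomorphic: "weight_fun l m holomorphic_on UNIV"
proof -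
  have "(\<lambda>z. K0 (z\<^sup>2)) holomorphic_on UNIV"
    using K0_square_deriv by (auto simp: holomorphic_on_open)
  then show ?thesis
    unfolding weight_fun_def by (auto intro!: holomorphic_intros)
qed

lemma weight_fun_deriv:
  "z * deriv (weight_fun l m) z = z ^ l * exp (- z\<^sup>2 / 2) * ((of_nat l - z\<^sup>2) * K0 (z\<^sup>2) + 2 * z\<^sup>2 * K1 (z\<^sup>2))"
  using deriv_power_gauss_mult[OF K0_square_deriv, of z l]
  by (simp add: weight_fun_def[abs_def] power2_eq_square mult.assoc)

text \<open>The left side is the radial part of eta^+ on weight m, up to the factor -1/2. Raising
  the weight by 4 lowers the Kummer parameter by 1, so \<open>kummer_lower\<close> enters here and
  \<open>kummer_raise\<close> in the lowering relation; the coefficient is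
  \<open>2 (b0 - a0)\<close>.\<close>

lemma weight_fun_raise:
  "z * deriv (weight_fun l m) z + (of_int m / 2 + 1 / 2 - z\<^sup>2) * weight_fun l m z
     = (2 * of_nat l + 1 + of_int m) / 2 * weight_fun l (m + 4) z"
proof -
  define e where "e = z ^ l * exp (- z\<^sup>2 / 2)"
  have G: "weight_fun l m z = e * K0 (z\<^sup>2)"
    and D: "z * deriv (weight_fun l m) z = e * ((of_nat l - z\<^sup>2) * K0 (z\<^sup>2) + 2 * z\<^sup>2 * K1 (z\<^sup>2))"
    by (simp_all add: weight_fun_def weight_fun_deriv e_def)
  have a: "(2 * of_nat l + 1 - of_int (m + 4)) / 4 = a0 - 1" by (simp add: field_simps)
  have "z * deriv (weight_fun l m) z + (of_int m / 2 + 1 / 2 - z\<^sup>2) * weight_fun l m z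
      = 2 * e * (z\<^sup>2 * K1 (z\<^sup>2) + (b0 - a0 - z\<^sup>2) * K0 (z\<^sup>2))"
    unfolding D G by (simp add: field_simps)
  also have "\<dots> = 2 * e * ((b0 - a0) * eval_fps (kummer (a0 - 1) b0) (z\<^sup>2))"
    by (subst kummer_lower) simp_all
  also have "\<dots> = (2 * of_nat l + 1 + of_int m) / 2 * weight_fun l (m + 4) z"
    unfolding weight_fun_def a e_def[symmetric] by (simp add: field_simps)
  finally show ?thesis .
qed

lemma weight_fun_lower:
  "z * deriv (weight_fun l m) z - (of_int m / 2 - 1 / 2 - z\<^sup>2) * weight_fun l m z
     = (2 * of_nat l + 1 - of_int m) / 2 * weight_fun l (m - 4) z"
proof -
  define e where "e = z ^ l * exp (- z\<^sup>2 / 2)"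
  have G: "weight_fun l m z = e * K0 (z\<^sup>2)"
    and D: "z * deriv (weight_fun l m) z = e * ((of_nat l - z\<^sup>2) * K0 (z\<^sup>2) + 2 * z\<^sup>2 * K1 (z\<^sup>2))"
    by (simp_all add: weight_fun_def weight_fun_deriv e_def)
  have a: "(2 * of_nat l + 1 - of_int (m - 4)) / 4 = a0 + 1" by (simp add: field_simps)
  have "z * deriv (weight_fun l m) z - (of_int m / 2 - 1 / 2 - z\<^sup>2) * weight_fun l m z
      = 2 * e * (z\<^sup>2 * K1 (z\<^sup>2) + a0 * K0 (z\<^sup>2))"
    unfolding D G by (simp add: field_simps)
  also have "\<dots> = 2 * e * (a0 * eval_fps (kummer (a0 + 1) b0) (z\<^sup>2))"
    by (subst kummer_raise) simp_all
  also have "\<dots> = (2 * of_nat l + 1 - of_int m) / 2 * weight_fun l (m - 4) z"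
    unfolding weight_fun_def a e_def[symmetric] by simp
  finally show ?thesis .
qed

text \<open>With the Euler operator E = z d/dz one has z^2 f'' = E(E f) - E f. After the common
  factor z^l exp(-z^2/2) is taken out, the difference of the two sides is 4 w times Kummer's
  equation at w = z^2.\<close>

lemma weight_fun_ode:
  "z\<^sup>2 * (of_int m * weight_fun l m z - z\<^sup>2 * weight_fun l m z + deriv (deriv (weight_fun l m)) z)
     = of_nat l * (of_nat l - 1) * weight_fun l m z"
proof -
  let ?Q = "\<lambda>z. (of_nat l - z\<^sup>2) * K0 (z\<^sup>2) + 2 * z\<^sup>2 * K1 (z\<^sup>2)"
  let ?P = "\<lambda>z. z ^ l * exp (- z\<^sup>2 / 2) * ?Q z"
  let ?Q' = "(of_nat l - z\<^sup>2) * (2 * z * K1 (z\<^sup>2)) - 2 * z * K0 (z\<^sup>2)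
      + (2 * z\<^sup>2 * (2 * z * K2 (z\<^sup>2)) + 4 * z * K1 (z\<^sup>2))"
  have "(?Q has_field_derivative ?Q') (at z)"
    by (rule derivative_eq_intros K0_square_deriv K1_square_deriv refl | simp)+
  from deriv_power_gauss_mult[OF this, of l]
  have P: "z * deriv ?P z = z ^ l * exp (- z\<^sup>2 / 2) * ((of_nat l - z\<^sup>2) * ?Q z + z * ?Q')" .
  have "deriv (weight_fun l m) holomorphic_on UNIV"
    using weight_fun_holomorphic by (simp add: holomorphic_deriv)
  then have "(deriv (weight_fun l m) has_field_derivative deriv (deriv (weight_fun l m)) z) (at z)"
    using holomorphic_derivI[of _ UNIV] by auto
  then have "((\<lambda>z. z * deriv (weight_fun l m) z) has_field_derivative
      deriv (weight_fun l m) z + z * deriv (deriv (weight_fun l m)) z) (at z)"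
    by (auto intro!: derivative_eq_intros)
  then have "deriv ?P z = deriv (weight_fun l m) z + z * deriv (deriv (weight_fun l m)) z"
    unfolding weight_fun_deriv by (rule DERIV_imp_deriv)
  then have D2: "z\<^sup>2 * deriv (deriv (weight_fun l m)) z = z * deriv ?P z - z * deriv (weight_fun l m) z"
    by (simp add: algebra_simps power2_eq_square)
  define e w k0 k1 k2 L A where "e = z ^ l * exp (- z\<^sup>2 / 2)" and "w = z\<^sup>2"
    and "k0 = K0 (z\<^sup>2)" and "k1 = K1 (z\<^sup>2)" and "k2 = K2 (z\<^sup>2)"
    and "L = (of_nat l :: complex)" and "A = a0"
  note defs = this
  \<comment> \<open>Replacing m by the Kummer parameter makes the rest a polynomial identity in
    \<open>L\<close>, \<open>A\<close>, \<open>w\<close> and the values \<open>k0\<close>,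
    \<open>k1\<close>, \<open>k2\<close>.\<close>
  have m: "of_int m = 2 * L + 1 - 4 * A"
    by (simp add: defs field_simps)
  have G: "weight_fun l m z = e * k0"
    by (simp add: weight_fun_def defs)
  have "z * ?Q' = (L - w) * (2 * w * k1) - 2 * w * k0 + (2 * w * (2 * w * k2) + 4 * w * k1)"
    by (simp add: defs algebra_simps power2_eq_square)
  then have D2': "w * deriv (deriv (weight_fun l m)) z
      = e * ((L - w) * ((L - w) * k0 + 2 * w * k1)
          + ((L - w) * (2 * w * k1) - 2 * w * k0 + (2 * w * (2 * w * k2) + 4 * w * k1)))
        - e * ((L - w) * k0 + 2 * w * k1)"
    using D2 unfolding P weight_fun_deriv defs by (simp only:)
  have "w * (of_int m * weight_fun l m z - w * weight_fun l m z + deriv (deriv (weight_fun l m)) z)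
      = w * (of_int m - w) * weight_fun l m z + w * deriv (deriv (weight_fun l m)) z"
    by (simp add: algebra_simps)
  also have "\<dots> - L * (L - 1) * weight_fun l m z = e * (4 * w * (w * k2 + (L + 1/2 - w) * k1 - A * k0))"
    unfolding D2' G m by (simp add: algebra_simps)
  also have "w * k2 + (L + 1/2 - w) * k1 - A * k0 = 0"
    unfolding defs by (rule kummer_ode) simp
  finally show ?thesis
    by (simp add: w_def L_def)
qed

lemma weight_fun_minus: "weight_fun l m (- z) = (- 1) ^ l * weight_fun l m z"
  by (simp add: weight_fun_def power_minus[of z])

text \<open>By Leibniz only the l-th derivative of z^l survives at 0, and the remaining factor is 1
  there. The nonzero value serves to compare the constants of a solution on the two
  half-lines.\<close>

lemma weight_fun_higher_deriv_0: "(deriv ^^ l) (weight_fun l m) 0 = fact l"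
proof -
  define H where "H z = exp (- z\<^sup>2 / 2) * K0 (z\<^sup>2)" for z
  have "(\<lambda>z. K0 (z\<^sup>2)) holomorphic_on UNIV"
    using K0_square_deriv by (auto simp: holomorphic_on_open)
  then have H: "H holomorphic_on UNIV"
    unfolding H_def by (auto intro!: holomorphic_intros)
  have "(deriv ^^ l) (\<lambda>z. z ^ l * H z) 0
      = (\<Sum>i = 0..l. of_nat (l choose i) * (deriv ^^ i) (\<lambda>z. z ^ l) 0 * (deriv ^^ (l - i)) H 0)"
    by (rule higher_deriv_mult[of _ UNIV]) (auto intro: H holomorphic_intros)
  also have "\<dots> = (\<Sum>i = 0..l. if i = l then fact l * H 0 else 0)"
  proof (rule sum.cong)
    fix i assume "i \<in> {0..l}"
    then show "of_nat (l choose i) * (deriv ^^ i) (\<lambda>z. z ^ l) 0 * (deriv ^^ (l - i)) H 0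
        = (if i = l then fact l * H 0 else 0)"
      using higher_deriv_power[of i 0 l 0] by (auto simp: pochhammer_fact)
  qed simp
  also have "\<dots> = fact l * H 0" by simp
  also have "H 0 = 1" by (simp add: H_def eval_fps_at_0 kummer_def)
  finally show ?thesis
    by (simp add: weight_fun_def[abs_def] H_def mult.assoc)
qed

text \<open>The Kummer factor is 1 at 0 and continuous. Farther out there can be zeros, since for a
  negative integer parameter it is a Laguerre polynomial, so base points are chosen near 0.\<close>

lemma weight_fun_nonzero_near_0:
  obtains \<delta> :: real where "\<delta> > 0" "\<And>y. 0 < y \<Longrightarrow> y < \<delta> \<Longrightarrow> weight_fun l m (of_real y) \<noteq> 0"
proof -
  have "((\<lambda>y::real. K0 ((of_real y)\<^sup>2)) has_vector_derivative 2 * of_real 0 * K1 ((of_real 0)\<^sup>2)) (at 0)"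
    by (rule has_vector_derivative_real_field) (rule K0_square_deriv)
  then have "((\<lambda>y::real. K0 ((of_real y)\<^sup>2)) \<longlongrightarrow> K0 0) (at 0)"
    by (drule_tac has_vector_derivative_continuous) (simp add: isCont_def)
  moreover have "K0 0 \<noteq> 0" by (simp add: eval_fps_at_0 kummer_def)
  ultimately have "\<forall>\<^sub>F y in at (0::real). K0 ((of_real y)\<^sup>2) \<noteq> 0"
    by (rule tendsto_imp_eventually_ne)
  then obtain \<delta> :: real where "\<delta> > 0" "\<And>y. y \<noteq> 0 \<Longrightarrow> \<bar>y\<bar> < \<delta> \<Longrightarrow> K0 ((of_real y)\<^sup>2) \<noteq> 0"
    by (auto simp: eventually_at dist_real_def)
  then show ?thesis
    by (intro that[of \<delta>]) (auto simp: weight_fun_def)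
qed

end


section \<open>Uniqueness for the radial equation\<close>

text \<open>Uniqueness is stated to the right of a point \<open>a\<close>, which will be positive,
  because the radial coefficient l(l-1)/y^2 is singular at 0.\<close>

lemma second_order_ode_zero:
  fixes u u' :: "real \<Rightarrow> complex" and p :: "real \<Rightarrow> real"
  assumes u: "\<And>t. a \<le> t \<Longrightarrow> (u has_vector_derivative u' t) (at t)"
    and u': "\<And>t. a \<le> t \<Longrightarrow> (u' has_vector_derivative of_real (p t) * u t) (at t)"
    and p: "continuous_on {a..} p"
    and init: "u a = 0" "u' a = 0"
    and "a \<le> b"
  shows "u b = 0"
proof -
  have "compact (p ` {a..b})"
    using p by (intro compact_continuous_image) (auto intro: continuous_on_subset)
  then have "bounded (p ` {a..b})"
    by (rule compact_imp_bounded)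
  then obtain B where "\<forall>x\<in>p ` {a..b}. norm x \<le> B"
    unfolding bounded_iff by blast
  then have B: "\<bar>p t\<bar> \<le> B" if "t \<in> {a..b}" for t
    using that by auto
  \<comment> \<open>The derivative of the energy |u|^2 + |u'|^2 is 2 (1 + p) <u, u'>, at most 1 + B
    times the energy; hence the exponent.\<close>
  define E where "E t = (u t \<bullet> u t + u' t \<bullet> u' t) * exp (- (1 + B) * t)" for t
  \<comment> \<open>Gronwall's inequality for the energy\<close>
  have "E b \<le> E a"
  proof (rule DERIV_nonpos_imp_nonincreasing[OF \<open>a \<le> b\<close>], intro exI conjI)
    fix t assume t: "a \<le> t" "t \<le> b"
    let ?D = "((2 * (1 + p t)) * (u t \<bullet> u' t) - (1 + B) * (u t \<bullet> u t + u' t \<bullet> u' t)) * exp (- (1 + B) * t)"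
    note uD = u[OF t(1), unfolded has_vector_derivative_def] and u'D = u'[OF t(1), unfolded has_vector_derivative_def]
    have "((\<lambda>t. u t \<bullet> u t) has_derivative (\<lambda>h. u t \<bullet> (h *\<^sub>R u' t) + (h *\<^sub>R u' t) \<bullet> u t)) (at t)"
      by (rule has_derivative_inner[OF uD uD])
    then have 1: "((\<lambda>t. u t \<bullet> u t) has_real_derivative 2 * (u t \<bullet> u' t)) (at t)"
      unfolding has_field_derivative_def by (rule has_derivative_eq_rhs) (auto simp: inner_commute)
    have "((\<lambda>t. u' t \<bullet> u' t) has_derivative (\<lambda>h. u' t \<bullet> (h *\<^sub>R (p t *\<^sub>R u t)) + (h *\<^sub>R (p t *\<^sub>R u t)) \<bullet> u' t)) (at t)"
      using has_derivative_inner[OF u'D u'D] by (simp only: scaleR_conv_of_real)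
    then have 2: "((\<lambda>t. u' t \<bullet> u' t) has_real_derivative 2 * p t * (u t \<bullet> u' t)) (at t)"
      unfolding has_field_derivative_def by (rule has_derivative_eq_rhs) (auto simp: inner_commute)
    show "(E has_real_derivative ?D) (at t)"
      unfolding E_def by (rule derivative_eq_intros 1 2 refl | simp)+ (simp add: algebra_simps)
    have "2 * \<bar>u t \<bullet> u' t\<bar> \<le> 2 * (norm (u t) * norm (u' t))"
      using Cauchy_Schwarz_ineq2[of "u t" "u' t"] by simp
    also have "\<dots> \<le> u t \<bullet> u t + u' t \<bullet> u' t"
      using sum_squares_bound[of "norm (u t)" "norm (u' t)"] by (simp add: dot_square_norm)
    finally have 3: "2 * \<bar>u t \<bullet> u' t\<bar> \<le> u t \<bullet> u t + u' t \<bullet> u' t" .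
    have "(2 * (1 + p t)) * (u t \<bullet> u' t) \<le> \<bar>(2 * (1 + p t)) * (u t \<bullet> u' t)\<bar>"
      by (rule abs_ge_self)
    also have "\<dots> = \<bar>1 + p t\<bar> * (2 * \<bar>u t \<bullet> u' t\<bar>)"
      by (simp add: abs_mult del: distrib_left_numeral)
    also have "\<dots> \<le> (1 + B) * (u t \<bullet> u t + u' t \<bullet> u' t)"
      using B[of t] t 3 by (intro mult_mono) auto
    finally show "?D \<le> 0"
      by (simp add: mult_nonpos_nonneg)
  qed
  then have "(u b \<bullet> u b + u' b \<bullet> u' b) * exp (- (1 + B) * b) \<le> 0"
    by (simp add: E_def init)
  then have "u b \<bullet> u b + u' b \<bullet> u' b \<le> 0"
    by (simp add: mult_le_0_iff)
  then have "u b \<bullet> u b = 0"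
    using inner_ge_zero[of "u b"] inner_ge_zero[of "u' b"] by linarith
  then show ?thesis by simp
qed

text \<open>Equality on an open set passes to all derivatives there, and by continuity to the
  closure. For an open half-line this determines every derivative at 0 from one side.\<close>

lemma iterated_derivatives_eq:
  fixes D E :: "nat \<Rightarrow> real \<Rightarrow> complex"
  assumes D: "\<And>k y. (D k has_vector_derivative D (Suc k) y) (at y)"
    and E: "\<And>k y. (E k has_vector_derivative E (Suc k) y) (at y)"
    and S: "open S" "\<And>y. y \<in> S \<Longrightarrow> D 0 y = E 0 y" and y: "y \<in> closure S"
  shows "D k y = E k y"
proof -
  have *: "D k y = E k y" if "y \<in> S" for y
    using that
  proof (induction k arbitrary: y)
    case (Suc k)
    have "(D k has_vector_derivative E (Suc k) y) (at y)"
      by (rule has_vector_derivative_transform_within_open[OF E \<open>open S\<close> Suc.prems]) (simp add: Suc.IH)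
    with D show ?case
      by (rule vector_derivative_unique_at)
  qed (simp add: S)
  have "continuous_on UNIV (\<lambda>y. D k y - E k y)"
    by (intro continuous_on_diff continuous_at_imp_continuous_on ballI has_vector_derivative_continuous[OF D]
        has_vector_derivative_continuous[OF E])
  then have "D k y - E k y = 0"
    by (rule continuous_constant_on_closure[OF continuous_on_subset _ y]) (auto simp: *)
  then show ?thesis by simp
qed

lemma has_vector_derivative_weight_fun:
  "((\<lambda>y. (deriv ^^ k) (weight_fun l m) (of_real y)) has_vector_derivative
     (deriv ^^ Suc k) (weight_fun l m) (of_real y)) (at y)"
proof (rule has_vector_derivative_real_field)
  have "(deriv ^^ k) (weight_fun l m) holomorphic_on UNIV"
    by (intro holomorphic_higher_deriv weight_fun_holomorphic) auto
  then show "((deriv ^^ k) (weight_fun l m) has_field_derivative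
     (deriv ^^ Suc k) (weight_fun l m) (of_real y)) (at (of_real y))"
    using holomorphic_derivI[of _ UNIV] by auto
qed

lemma weight_fun_0: "l \<noteq> 0 \<Longrightarrow> weight_fun l m 0 = 0"
  by (simp add: weight_fun_def)

lemma deriv_weight_fun_0:
  assumes "l \<noteq> 1"
  shows "deriv (weight_fun l m) 0 = 0"
proof -
  have D: "((\<lambda>z. z ^ l * (exp (- z\<^sup>2 / 2) *
      eval_fps (kummer ((2 * of_nat l + 1 - of_int m) / 4) (of_nat l + 1 / 2)) (z\<^sup>2))) has_field_derivative
      of_nat l * 0 ^ (l - 1) * (1 * eval_fps (kummer ((2 * of_nat l + 1 - of_int m) / 4) (of_nat l + 1 / 2)) 0)) (at 0)"
    by (rule derivative_eq_intros K0_square_deriv refl | simp)+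
  \<comment> \<open>For l = 0 the first factor vanishes, for l >= 2 the power of 0 does.\<close>
  have "of_nat l * (0::complex) ^ (l - 1) = 0"
    using assms by (cases l) auto
  from DERIV_imp_deriv[OF D[unfolded this]] show ?thesis
    by (simp add: weight_fun_def[abs_def] mult.assoc)
qed

text \<open>\<open>D k\<close> is the k-th derivative of an unknown radial solution and
  \<open>\<epsilon>\<close> its parity sign. The sign is prescribed for l <= 1, as in the definition
  of H_0 and H_1; for l >= 2 it is left open and gets determined below.\<close>

context
  fixes l :: nat and m :: int and D :: "nat \<Rightarrow> real \<Rightarrow> complex" and \<epsilon> :: complex
  assumes D: "\<And>k y. (D k has_vector_derivative D (Suc k) y) (at y)"
    and ode: "\<And>y. (of_real y)\<^sup>2 * (of_int m * D 0 y - (of_real y)\<^sup>2 * D 0 y + D 2 y)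
        = of_nat l * (of_nat l - 1) * D 0 y"
    and parity: "\<And>y. D 0 (- y) = \<epsilon> * D 0 y"
    and eps: "\<epsilon> = 1 \<or> \<epsilon> = - 1" "l \<le> 1 \<Longrightarrow> \<epsilon> = (- 1) ^ l"
begin

private abbreviation (input) "G k y \<equiv> (deriv ^^ k) (weight_fun l m) (of_real y)"

lemma G_ode:
  "(of_real y)\<^sup>2 * (of_int m * G 0 y - (of_real y)\<^sup>2 * G 0 y + G 2 y) = of_nat l * (of_nat l - 1) * G 0 y"
  using weight_fun_ode[of "of_real y" m l] by (simp add: numeral_2_eq_2)

text \<open>The Wronskian is constant off \<open>0\<close>, hence everywhere by continuity, and at \<open>0\<close> it vanishes
  because both values vanish (\<open>l \<ge> 2\<close>) or by parity (\<open>l \<le> 1\<close>).\<close>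

lemma wronskian_zero: "D 0 y * G 1 y = D 1 y * G 0 y"
proof -
  define W where "W y = D 0 y * G 1 y - D 1 y * G 0 y" for y
  have W: "(W has_vector_derivative D 0 y * G 2 y - D 2 y * G 0 y) (at y)" for y
  proof -
    have "((\<lambda>y. D 0 y * G 1 y - D 1 y * G 0 y) has_vector_derivative
        (D 0 y * G (Suc 1) y + D (Suc 0) y * G 1 y) - (D 1 y * G (Suc 0) y + D (Suc 1) y * G 0 y)) (at y)"
      by (intro has_vector_derivative_diff has_vector_derivative_mult D has_vector_derivative_weight_fun)
    then show ?thesis
      by (simp add: W_def[abs_def] numeral_2_eq_2)
  qed
  have W0: "(W has_derivative (\<lambda>h. 0)) (at y within UNIV)" if "y \<in> UNIV - {0}" for y
  proof -
    \<comment> \<open>Each equation is multiplied by the other solution; in the difference the terms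
      with m, y^2 and the eigenvalue cancel.\<close>
    have "(of_real y)\<^sup>2 * (D 0 y * G 2 y - D 2 y * G 0 y)
      = D 0 y * ((of_real y)\<^sup>2 * (of_int m * G 0 y - (of_real y)\<^sup>2 * G 0 y + G 2 y))
        - G 0 y * ((of_real y)\<^sup>2 * (of_int m * D 0 y - (of_real y)\<^sup>2 * D 0 y + D 2 y))"
      by (simp add: algebra_simps)
    also have "\<dots> = 0"
      unfolding ode G_ode by (simp add: mult_ac)
    finally have "D 0 y * G 2 y - D 2 y * G 0 y = 0"
      using that by simp
    then show ?thesis
      using W[of y] by (simp add: has_vector_derivative_def)
  qed
  have "continuous_on UNIV W"
    using W by (intro continuous_at_imp_continuous_on ballI has_vector_derivative_continuous) blast
  then have "W y = W 0"
    by (intro has_derivative_zero_unique_strong_convex[OF convex_UNIV _ _ UNIV_I refl W0 UNIV_I, of "{0}"]) simp_all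
  also have "W 0 = 0"
  proof -
    \<comment> \<open>Differentiating the parity relation at 0 gives
      \<open>- D 1 0 = \<epsilon> * D 1 0\<close>, which makes \<open>D 1 0\<close> vanish in the
      even case l = 0.\<close>
    have "((\<lambda>y::real. - y) has_vector_derivative - 1) (at 0)"
      by (rule has_vector_derivative_minus[OF has_vector_derivative_id, unfolded id_def])
    from vector_diff_chain_at[OF this, of "D 0" "D 1 0"]
    have "((\<lambda>y. D 0 (- y)) has_vector_derivative - D 1 0) (at 0)"
      using D[of 0 0] by (simp add: o_def)
    moreover have "((\<lambda>y. D 0 (- y)) has_vector_derivative \<epsilon> * D 1 0) (at 0)"
      unfolding parity using has_vector_derivative_mult_right[OF D[of 0 0], of \<epsilon>] by simp
    ultimately have D1: "- D 1 0 = \<epsilon> * D 1 0"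
      by (rule vector_derivative_unique_at)
    show ?thesis
    proof (cases "l = 0")
      case True
      then have "\<epsilon> = 1"
        using eps(2) by simp
      have "D 1 0 = 0"
        using D1 unfolding \<open>\<epsilon> = 1\<close> by (simp add: complex_eq_iff)
      then show ?thesis
        using True deriv_weight_fun_0[of l m] by (simp add: W_def)
    next
      case False
      show ?thesis
      proof (cases "l = 1")
        case True
        then have "D 0 0 = 0"
          using parity[of 0] eps by simp
        with True show ?thesis
          using weight_fun_0[of l m] by (simp add: W_def)
      next
        case False
        with \<open>l \<noteq> 0\<close> show ?thesis
          using weight_fun_0[of l m] deriv_weight_fun_0[of l m] by (simp add: W_def)
      qed
    qed
  qed
  finally show ?thesis
    by (simp add: W_def)
qed

text \<open>The constant makes \<open>D 0 - c * G 0\<close> vanish at \<open>a\<close>; the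
  vanishing Wronskian then makes its derivative vanish there too, and uniqueness of the initial
  value problem applies.\<close>

lemma proportional_from:
  assumes "0 < a" "weight_fun l m (of_real a) \<noteq> 0" "a \<le> y"
  shows "D 0 y = D 0 a / weight_fun l m (of_real a) * weight_fun l m (of_real y)"
proof -
  define c where "c = D 0 a / weight_fun l m (of_real a)"
  define p where "p y = (real l * (real l - 1) - of_int m * y\<^sup>2 + y ^ 4) / y\<^sup>2" for y :: real
  define u where "u k y = D k y - c * G k y" for k y
  have u: "(u k has_vector_derivative u (Suc k) y) (at y)" for k y
    unfolding u_def by (intro has_vector_derivative_diff has_vector_derivative_mult_right D has_vector_derivative_weight_fun)
  have u2: "u 2 t = of_real (p t) * u 0 t" if "a \<le> t" for t
  proof -
    have "t \<noteq> 0" using that \<open>0 < a\<close> by auto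
    have "(of_real t)\<^sup>2 * (of_int m * u 0 t - (of_real t)\<^sup>2 * u 0 t + u 2 t)
      = ((of_real t)\<^sup>2 * (of_int m * D 0 t - (of_real t)\<^sup>2 * D 0 t + D 2 t))
       - c * ((of_real t)\<^sup>2 * (of_int m * G 0 t - (of_real t)\<^sup>2 * G 0 t + G 2 t))"
      by (simp add: u_def algebra_simps)
    also have "\<dots> = of_nat l * (of_nat l - 1) * u 0 t"
      unfolding ode G_ode by (simp add: u_def algebra_simps)
    finally have "(of_real t)\<^sup>2 * u 2 t = (of_nat l * (of_nat l - 1) - of_int m * (of_real t)\<^sup>2 + of_real t ^ 4) * u 0 t"
      by (simp add: algebra_simps power2_eq_square power4_eq_xxxx)
    also have "\<dots> = (of_real t)\<^sup>2 * (of_real (p t) * u 0 t)"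
      using \<open>t \<noteq> 0\<close> by (simp add: p_def)
    finally show ?thesis
      using \<open>t \<noteq> 0\<close> by simp
  qed
  have "u 0 y = 0"
  proof (rule second_order_ode_zero[of a "u 0" "u 1" p])
    show "continuous_on {a..} p"
      unfolding p_def using \<open>0 < a\<close> by (auto intro!: continuous_intros)
    show "u 0 a = 0"
      using assms by (simp add: u_def c_def)
    show "u 1 a = 0"
      using wronskian_zero[of a] assms by (simp add: u_def c_def field_simps)
    show "(u 1 has_vector_derivative of_real (p t) * u 0 t) (at t)" if "a \<le> t" for t
      using u[of 1 t] u2[OF that] by (simp add: numeral_2_eq_2)
    show "(u 0 has_vector_derivative u 1 t) (at t)" for t
      using u[of 0 t] by simp
  qed fact
  then show ?thesis
    by (simp add: u_def c_def)
qed

text \<open>A nonzero solution of the wrong parity would be a multiple of |y| y^(l-1) to leading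
  order at 0, whose l-th derivative jumps; this is where derivatives of arbitrarily high order are
  used.\<close>

lemma weight_ode_solution:
  obtains c where "\<And>y. D 0 y = c * weight_fun l m (of_real y)" "\<epsilon> \<noteq> (- 1) ^ l \<Longrightarrow> c = 0"
proof -
  obtain \<delta> :: real where \<delta>: "\<delta> > 0" "\<And>y. 0 < y \<Longrightarrow> y < \<delta> \<Longrightarrow> weight_fun l m (of_real y) \<noteq> 0"
    using weight_fun_nonzero_near_0 by blast
  define c where "c = D 0 (\<delta> / 2) / weight_fun l m (of_real (\<delta> / 2))"
  have pos: "D 0 y = c * weight_fun l m (of_real y)" if "y > 0" for y
  proof (cases "\<delta> / 2 \<le> y")
    case True
    then show ?thesis
      unfolding c_def using \<delta> by (intro proportional_from \<delta>(2)) auto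
  next
    case False
    \<comment> \<open>\<open>proportional_from\<close> runs only to the right, so \<open>y\<close>
      is the base point here and the relation at \<open>\<delta> / 2\<close> is solved for
      \<open>D 0 y\<close>.\<close>
    with that \<delta> have half: "D 0 (\<delta> / 2) = D 0 y / weight_fun l m (of_real y) * weight_fun l m (of_real (\<delta> / 2))"
      by (intro proportional_from \<delta>(2)) auto
    have "weight_fun l m (of_real (\<delta> / 2)) \<noteq> 0" "weight_fun l m (of_real y) \<noteq> 0"
      using \<delta>(1) False that \<delta>(2)[of "\<delta> / 2"] \<delta>(2)[of y] by (simp_all del: of_real_divide)
    then show ?thesis
      unfolding c_def half by (simp del: of_real_divide)
  qed
  have E: "((\<lambda>y. d * G k y) has_vector_derivative d * G (Suc k) y) (at y)" for d k y
    by (intro has_vector_derivative_mult_right has_vector_derivative_weight_fun)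
  have nonneg: "D k y = c * G k y" if "0 \<le> y" for k y
    by (rule iterated_derivatives_eq[of D "\<lambda>k y. c * G k y" "{0<..}", OF D E]) (use that in \<open>simp_all add: pos\<close>)
  \<comment> \<open>The coefficients on the two half-lines are matched through the \<open>l\<close>-th derivative at \<open>0\<close>.\<close>
  define d where "d = \<epsilon> * (- 1) ^ l * c"
  have neg: "D 0 y = d * weight_fun l m (of_real y)" if "y < 0" for y
    using pos[of "- y"] parity[of "- y"] that weight_fun_minus[of l m "of_real y"] by (simp add: d_def)
  have nonpos: "D k y = d * G k y" if "y \<le> 0" for k y
    by (rule iterated_derivatives_eq[of D "\<lambda>k y. d * G k y" "{..<0}", OF D E]) (use that in \<open>simp_all add: neg\<close>)
  have "c * G l 0 = d * G l 0"
    using nonneg[of 0 l] nonpos[of 0 l] by (metis order_refl)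
  then have "c = d"
    using weight_fun_higher_deriv_0[of l m] by simp
  have "D 0 y = c * weight_fun l m (of_real y)" for y
    using nonneg[of y 0] nonpos[of y 0] \<open>c = d\<close> by (cases "0 \<le> y") auto
  moreover have "c = 0" if "\<epsilon> \<noteq> (- 1) ^ l"
  proof -
    have "\<epsilon> * (- 1) ^ l = - 1"
      using that eps(1) by (cases "even l") auto
    then show ?thesis
      using \<open>c = d\<close> by (simp add: d_def complex_eq_iff)
  qed
  ultimately show ?thesis
    using that by blast
qed

end


section \<open>The weight basis of the solution space\<close>

lemma i_powi_eq_1_iff: "\<i> powi n = 1 \<longleftrightarrow> 4 dvd n"
proof -
  have "n = 4 * (n div 4) + n mod 4" by simp
  then have "\<i> powi n = \<i> powi (4 * (n div 4)) * \<i> powi (n mod 4)"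
    by (metis power_int_add complex_i_not_zero)
  also have "\<i> powi (4 * (n div 4)) = (\<i> powi 4) powi (n div 4)"
    by (rule power_int_mult)
  also have "\<dots> = 1"
    by simp
  finally have n: "\<i> powi n = \<i> powi (n mod 4)" by simp
  have "n mod 4 \<in> {0, 1, 2, 3}" by auto
  then show ?thesis
    unfolding n dvd_eq_mod_eq_0 by (auto simp: power3_eq_cube complex_eq_iff)
qed

lemma i_powi_cong: "4 dvd m - n \<Longrightarrow> \<i> powi m = \<i> powi n"
  using i_powi_eq_1_iff[of "m - n"] by (simp add: power_int_diff)

lemma exp_weight_pi: "exp (- \<i> * of_int m * (of_real \<theta> + of_int j * of_real pi) / 2)
    = \<i> powi (- (m * j)) * exp (- \<i> * of_int m * of_real \<theta> / 2)"
proof -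
  have "\<i> = exp (\<i> * of_real pi / 2)"
    using cis_pi_half by (simp add: cis_conv_exp mult.commute)
  then have pow: "\<i> powi (- (m * j)) = exp (of_int (- (m * j)) * (\<i> * of_real pi / 2))"
    by (metis exp_power_int)
  show ?thesis
    unfolding pow exp_add[symmetric] by (rule arg_cong[of _ _ exp]) (simp add: field_simps)
qed

text \<open>The vector v_m, defined for every integer m: the formulas for the action then hold
  without a congruence condition, which enters only for membership in the induced space.\<close>

definition wvec :: "nat \<Rightarrow> int \<Rightarrow> cfun" where
  "wvec l m = wt m (\<lambda>y. weight_fun l m (of_real y))"

lemma smooth_wvec: "smooth (wvec l m)"
proof -
  have "smooth (\<lambda>(\<theta>, y). (\<lambda>z. exp (- \<i> * of_int m * z / 2)) (of_real \<theta>) * weight_fun l m (of_real y))"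
    by (intro smooth_entire_product weight_fun_holomorphic holomorphic_intros) auto
  then show ?thesis
    by (simp add: wvec_def wt_def)
qed

lemma wvec_nonzero: "wvec l m \<noteq> 0"
proof -
  obtain \<delta> :: real where "\<delta> > 0" "\<And>y. 0 < y \<Longrightarrow> y < \<delta> \<Longrightarrow> weight_fun l m (of_real y) \<noteq> 0"
    using weight_fun_nonzero_near_0 by blast
  then have "weight_fun l m (of_real (\<delta> / 2)) \<noteq> 0"
    by (simp del: of_real_divide)
  then show ?thesis
    unfolding wvec_def wt_eq_0_iff by blast
qed

lemma weight_vector_wvec: "weight_vector m (wvec l m)"
  using wvec_nonzero by (auto simp: weight_vector_wt wvec_def)

lemma wvec_minus: "wvec l m (\<theta>, - y) = (- 1) ^ l * wvec l m (\<theta>, y)"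
  by (simp add: wvec_def wt_def weight_fun_minus)

text \<open>The translation by j pi contributes i^(-mj) and the reflection of y contributes
  (-1)^(lj) = i^(2lj); the product is i^(-jq) because the exponents differ by a multiple of m - q -
  2l.\<close>

lemma wvec_in_I_cpt:
  assumes "4 dvd m - q - 2 * int l"
  shows "wvec l m \<in> I_cpt q"
proof -
  have "wvec l m (\<theta> + of_int j * pi, (- 1) powi j * y) = \<i> powi (- j * q) * wvec l m (\<theta>, y)" for j \<theta> y
  proof -
    have "weight_fun l m (of_real ((- 1) powi j * y)) = \<i> powi (2 * int l * j) * weight_fun l m (of_real y)"
    proof (cases "even j")
      case True
      then have "\<i> powi (2 * int l * j) = 1"
        unfolding i_powi_eq_1_iff by auto
      with True show ?thesis by simp
    next
      case False
      then have "4 dvd 2 * int l * j - 2 * int l"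
        by (elim oddE) (simp add: algebra_simps)
      then have "\<i> powi (2 * int l * j) = \<i> powi (2 * int l)"
        by (rule i_powi_cong)
      also have "\<dots> = (- 1) ^ l"
        by (simp add: power_int_mult)
      finally show ?thesis
        using False by (simp add: weight_fun_minus)
    qed
    then have "wvec l m (\<theta> + of_int j * pi, (- 1) powi j * y)
        = (\<i> powi (- (m * j)) * \<i> powi (2 * int l * j)) * wvec l m (\<theta>, y)"
      using exp_weight_pi[of m \<theta> j] by (simp add: wvec_def wt_def mult_ac)
    also have "\<i> powi (- (m * j)) * \<i> powi (2 * int l * j) = \<i> powi (- (m * j) + 2 * int l * j)"
      by (rule power_int_add[symmetric]) simp
    also have "\<dots> = \<i> powi (- j * q)"
    proof (rule i_powi_cong)
      have "- (m * j) + 2 * int l * j - - j * q = (m - q - 2 * int l) * (- j)"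
        by (simp add: algebra_simps)
      then show "4 dvd - (m * j) + 2 * int l * j - - j * q"
        using assms by (metis dvd_mult2)
    qed
    finally show ?thesis .
  qed
  then show ?thesis
    by (auto simp: I_cpt_def smooth_wvec)
qed

lemma d_y_wvec: "d_y (wvec l m) = wt m (\<lambda>y. deriv (weight_fun l m) (of_real y))"
  and d_y_d_y_wvec: "d_y (d_y (wvec l m)) = wt m (\<lambda>y. deriv (deriv (weight_fun l m)) (of_real y))"
proof -
  show *: "d_y (wvec l m) = wt m (\<lambda>y. deriv (weight_fun l m) (of_real y))"
    unfolding wvec_def using has_vector_derivative_weight_fun[of 0] by (intro d_y_wt) simp
  show "d_y (d_y (wvec l m)) = wt m (\<lambda>y. deriv (deriv (weight_fun l m)) (of_real y))"
    unfolding * using has_vector_derivative_weight_fun[of 1] by (intro d_y_wt) simp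
qed

lemma d_theta_wvec: "d_theta (wvec l m) p = - \<i> * of_int m / 2 * wvec l m p"
  unfolding wvec_def by (rule d_theta_wt)

lemma kappa_op_wvec: "kappa_op (wvec l m) = cscale (of_int m / 2) (wvec l m)"
  unfolding wvec_def by (rule kappa_op_wt)

lemma eta_plus_op_wvec:
  "eta_plus_op (wvec l m) = cscale (- (2 * of_nat l + 1 + of_int m) / 4) (wvec l (m + 4))"
proof
  fix p :: "real \<times> real"
  obtain \<theta> y where p: "p = (\<theta>, y)" by force
  let ?e = "exp (- \<i> * of_int m * of_real \<theta> / 2)" and ?g = "weight_fun l m (of_real y)"
  have e: "exp (- 2 * \<i> * of_real \<theta>) * ?e = exp (- \<i> * of_int (m + 4) * of_real \<theta> / 2)"
    unfolding exp_add[symmetric] by (rule arg_cong[of _ _ exp]) (simp add: field_simps)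
  have "eta_plus_op (wvec l m) p = - 1/2 * (exp (- 2 * \<i> * of_real \<theta>) * ?e) *
      (of_real y * deriv (weight_fun l m) (of_real y) + (of_int m / 2 + 1/2 - (of_real y)\<^sup>2) * ?g)"
    unfolding eta_plus_op_def p prod.case d_theta_wvec d_y_wvec
    by (simp add: wvec_def wt_def) (simp add: field_simps)
  also have "\<dots> = cscale (- (2 * of_nat l + 1 + of_int m) / 4) (wvec l (m + 4)) p"
    unfolding weight_fun_raise e by (simp add: p cscale_def wvec_def wt_def) (simp add: algebra_simps)
  finally show "eta_plus_op (wvec l m) p = cscale (- (2 * of_nat l + 1 + of_int m) / 4) (wvec l (m + 4)) p" .
qed

lemma eta_minus_op_wvec:
  "eta_minus_op (wvec l m) = cscale (- (2 * of_nat l + 1 - of_int m) / 4) (wvec l (m - 4))"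
proof
  fix p :: "real \<times> real"
  obtain \<theta> y where p: "p = (\<theta>, y)" by force
  let ?e = "exp (- \<i> * of_int m * of_real \<theta> / 2)" and ?g = "weight_fun l m (of_real y)"
  have e: "exp (2 * \<i> * of_real \<theta>) * ?e = exp (- \<i> * of_int (m - 4) * of_real \<theta> / 2)"
    unfolding exp_add[symmetric] by (rule arg_cong[of _ _ exp]) (simp add: field_simps)
  have "eta_minus_op (wvec l m) p = - 1/2 * (exp (2 * \<i> * of_real \<theta>) * ?e) *
      (of_real y * deriv (weight_fun l m) (of_real y) - (of_int m / 2 - 1/2 - (of_real y)\<^sup>2) * ?g)"
    unfolding eta_minus_op_def p prod.case d_theta_wvec d_y_wvec
    by (simp add: wvec_def wt_def) (simp add: field_simps)
  also have "\<dots> = cscale (- (2 * of_nat l + 1 - of_int m) / 4) (wvec l (m - 4)) p"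
    unfolding weight_fun_lower e by (simp add: p cscale_def wvec_def wt_def) (simp add: algebra_simps)
  finally show "eta_minus_op (wvec l m) p = cscale (- (2 * of_nat l + 1 - of_int m) / 4) (wvec l (m - 4)) p" .
qed

lemma Omega_op_wvec: "Omega_op (wvec l m) = cscale (of_nat l * (of_nat l - 1)) (wvec l m)"
proof
  fix p :: "real \<times> real"
  obtain \<theta> y where p: "p = (\<theta>, y)" by force
  let ?e = "exp (- \<i> * of_int m * of_real \<theta> / 2)" and ?g = "weight_fun l m (of_real y)"
  have "Omega_op (wvec l m) p = ?e * ((of_real y)\<^sup>2 *
      (of_int m * ?g - (of_real y)\<^sup>2 * ?g + deriv (deriv (weight_fun l m)) (of_real y)))"
    unfolding Omega_op_def p prod.case d_theta_wvec d_y_d_y_wvec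
    by (simp add: wvec_def wt_def) (simp add: field_simps)
  then show "Omega_op (wvec l m) p = cscale (of_nat l * (of_nat l - 1)) (wvec l m) p"
    unfolding weight_fun_ode by (simp add: p cscale_def wvec_def wt_def)
qed

definition weights :: "int \<Rightarrow> nat \<Rightarrow> int set" where
  "weights q l = {m. 4 dvd m - q - 2 * int l}"

section \<open>The solution space as the span of its weight vectors\<close>

lemma H_space_subspace: "cfun.subspace (H_space q l)"
proof (rule cfun.subspaceI)
  note I = cfun.subspace_0[OF I_cpt_subspace] cfun.subspace_add[OF I_cpt_subspace] cfun.subspace_scale[OF I_cpt_subspace]
  have smooth: "F \<in> I_cpt q \<Longrightarrow> smooth F" for F
    by (simp add: I_cpt_def)
  \<comment> \<open>\<open>wvec 0 0\<close> serves only as some smooth function, scaled by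
    0.\<close>
  have "Omega_op 0 = 0"
    using Omega_op_cscale[OF smooth_wvec, of 0 0 0] by (simp del: zero_fun_apply)
  then show "0 \<in> H_space q l"
    by (auto simp: H_space_def Omega_ker_def I K_finite_def cfun.span_zero)
  show "F + G \<in> H_space q l" if "F \<in> H_space q l" "G \<in> H_space q l" for F G
    using that by (auto simp: H_space_def Omega_ker_def I K_finite_def cfun.span_add Omega_op_add smooth
        cfun.scale_right_distrib)
  show "cscale c F \<in> H_space q l" if "F \<in> H_space q l" for F c
    using that by (auto simp: H_space_def Omega_ker_def I K_finite_def cfun.span_scale Omega_op_cscale smooth mult.commute)
      (auto simp: cscale_def)
qed

lemma wvec_in_H_space:
  assumes "m \<in> weights q l"
  shows "wvec l m \<in> H_space q l"
proof -
  have I: "wvec l m \<in> I_cpt q"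
    using assms by (simp add: weights_def wvec_in_I_cpt)
  then have "K_finite q (wvec l m)"
    unfolding K_finite_def using weight_vector_wvec by (intro cfun.span_base) auto
  with I show ?thesis
    by (auto simp: H_space_def Omega_ker_def Omega_op_wvec wvec_minus)
qed

lemma K_finite_weight_decomposition:
  assumes "K_finite q F"
  obtains M g where "finite M" "F = (\<Sum>m\<in>M. wt m (g m))" "\<And>m. wt m (g m) \<in> I_cpt q"
proof -
  note I = cfun.subspace_0[OF I_cpt_subspace] cfun.subspace_add[OF I_cpt_subspace] cfun.subspace_scale[OF I_cpt_subspace]
  \<comment> \<open>Components are indexed by weight, so spanning vectors of equal weight merge, and
    they are zero off \<open>M\<close>, so two decompositions can be added over the union of their
    index sets.\<close>
  define P where "P F M g \<longleftrightarrow> finite M \<and> F = (\<Sum>m\<in>M. wt m (g m)) \<and> (\<forall>m. wt m (g m) \<in> I_cpt q)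
    \<and> (\<forall>m. m \<notin> M \<longrightarrow> g m = (\<lambda>_. 0))" for F M g
  have "cfun.span {G \<in> I_cpt q. \<exists>m. weight_vector m G} \<subseteq> {F. \<exists>M g. P F M g}"
  proof (rule cfun.span_minimal, rule_tac[1] subsetI)
    show "cfun.subspace {F. \<exists>M g. P F M g}"
    proof (rule cfun.subspaceI)
      have "P 0 {} (\<lambda>_ _. 0)"
        by (simp add: P_def wt_zero I)
      then show "0 \<in> {F. \<exists>M g. P F M g}" by blast
    next
      fix F1 F2 assume "F1 \<in> {F. \<exists>M g. P F M g}" "F2 \<in> {F. \<exists>M g. P F M g}"
      then obtain M1 g1 M2 g2 where 1: "P F1 M1 g1" and 2: "P F2 M2 g2" by blast
      have "F1 = (\<Sum>m\<in>M1 \<union> M2. wt m (g1 m))" "F2 = (\<Sum>m\<in>M1 \<union> M2. wt m (g2 m))"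
        using 1 2 by (auto simp: P_def wt_zero intro!: sum.mono_neutral_left)
      then have "P (F1 + F2) (M1 \<union> M2) (\<lambda>m y. g1 m y + g2 m y)"
        using 1 2 by (simp add: P_def wt_add sum.distrib I)
      then show "F1 + F2 \<in> {F. \<exists>M g. P F M g}" by blast
    next
      fix c F1 assume "F1 \<in> {F. \<exists>M g. P F M g}"
      then obtain M g where "P F1 M g" by blast
      then have "P (cscale c F1) M (\<lambda>m y. c * g m y)"
        by (simp add: P_def wt_cmult cfun.scale_sum_right I)
      then show "cscale c F1 \<in> {F. \<exists>M g. P F M g}" by blast
    qed
  next
    fix G assume "G \<in> {G \<in> I_cpt q. \<exists>m. weight_vector m G}"
    then obtain m g where "wt m g \<in> I_cpt q" "G = wt m g"
      by (auto simp: weight_vector_wt)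
    then have "P G {m} (\<lambda>n. if n = m then g else (\<lambda>_. 0))"
      by (simp add: P_def wt_zero I)
    then show "G \<in> {F. \<exists>M g. P F M g}" by blast
  qed
  then show ?thesis
    using assms that unfolding P_def K_finite_def by blast
qed

text \<open>The profile \<open>g\<close> is the restriction of \<open>wt m g\<close> to theta = 0,
  so its regularity is inherited from the function on the plane.\<close>

lemma d_y_wt_smooth:
  assumes "smooth (wt m g)"
  shows "d_y (wt m g) = wt m (\<lambda>y. d_y (wt m g) (0, y))"
  using has_vector_derivative_d_y[OF smooth_imp_differentiable[OF assms], of 0] by (intro d_y_wt) simp

lemma Omega_op_wt:
  assumes "smooth (wt m g)"
  shows "Omega_op (wt m g) = wt m (\<lambda>y. (of_real y)\<^sup>2 *
    (of_int m * g y - (of_real y)\<^sup>2 * g y + d_y (d_y (wt m g)) (0, y)))"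
proof
  fix p :: "real \<times> real"
  obtain \<theta> y where p: "p = (\<theta>, y)" by force
  note d_y_eq = d_y_wt_smooth[OF assms]
  have "smooth (wt m (\<lambda>y. d_y (wt m g) (0, y)))"
    using smooth_d_y[OF assms] by (simp only: d_y_eq[symmetric])
  from d_y_wt_smooth[OF this]
  have "d_y (d_y (wt m g)) = wt m (\<lambda>y. d_y (d_y (wt m g)) (0, y))"
    by (simp only: d_y_eq[symmetric])
  then have "d_y (d_y (wt m g)) (\<theta>, y) = wt m (\<lambda>y. d_y (d_y (wt m g)) (0, y)) (\<theta>, y)"
    by (rule fun_cong)
  also have "\<dots> = exp (- \<i> * of_int m * of_real \<theta> / 2) * d_y (d_y (wt m g)) (0, y)"
    unfolding wt_def by simp
  finally show "Omega_op (wt m g) p = wt m (\<lambda>y. (of_real y)\<^sup>2 *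
    (of_int m * g y - (of_real y)\<^sup>2 * g y + d_y (d_y (wt m g)) (0, y))) p"
    unfolding Omega_op_def p prod.case d_theta_wt by (simp add: wt_def) (simp add: field_simps)
qed

lemma Omega_op_sum:
  assumes "\<And>i. i \<in> A \<Longrightarrow> smooth (f i)"
  shows "Omega_op (\<Sum>i\<in>A. f i) = (\<Sum>i\<in>A. Omega_op (f i)) \<and> smooth (\<Sum>i\<in>A. f i)"
proof -
  have "smooth 0"
    using smooth_cscale[OF smooth_wvec, of 0] by (simp del: zero_fun_apply)
  moreover have "Omega_op 0 = 0"
    using Omega_op_cscale[OF smooth_wvec, of 0 0 0] by (simp del: zero_fun_apply)
  ultimately show ?thesis
    using assms by (induction A rule: infinite_finite_induct) (simp_all add: Omega_op_add smooth_add)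
qed

lemma weight_solution:
  assumes I: "wt m g \<in> I_cpt q"
    and ode: "\<And>y. (of_real y)\<^sup>2 * (of_int m * g y - (of_real y)\<^sup>2 * g y + d_y (d_y (wt m g)) (0, y))
        = of_nat l * (of_nat l - 1) * g y"
    and par: "\<And>y. l \<le> 1 \<Longrightarrow> g (- y) = (- 1) ^ l * g y"
  obtains c where "wt m g = cscale c (wvec l m)" "c \<noteq> 0 \<Longrightarrow> m \<in> weights q l"
proof (cases "\<forall>y. g y = 0")
  case True
  then show ?thesis
    using that[of 0] by (simp add: wt_eq_0_iff)
next
  case False
  then obtain z where z: "g z \<noteq> 0" by blast
  have smooth: "smooth (wt m g)"
    using I by (simp add: I_cpt_def)
  \<comment> \<open>The case j = 1 of equivariance shifts theta by pi and reflects y, so the weight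
    fixes the parity sign. Reflecting twice at a point where \<open>g\<close> is nonzero forces the
    sign to square to 1.\<close>
  define \<epsilon> where "\<epsilon> = \<i> powi (m - q)"
  have parity: "g (- y) = \<epsilon> * g y" for y
  proof -
    have "wt m g (0 + of_int 1 * pi, (- 1) powi 1 * y) = \<i> powi (- 1 * q) * wt m g (0, y)"
      using I unfolding I_cpt_def by blast
    then have "\<i> powi (- m) * g (- y) = \<i> powi (- q) * g y"
      using exp_weight_pi[of m 0 1] by (simp add: wt_def)
    then have "\<i> powi m * (\<i> powi (- m) * g (- y)) = \<i> powi m * (\<i> powi (- q) * g y)"
      by (rule arg_cong)
    then show ?thesis
      by (simp add: \<epsilon>_def flip: mult.assoc power_int_add)
  qed
  have "g z = \<epsilon> * (\<epsilon> * g z)"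
    using parity[of z] parity[of "- z"] by simp
  then have "\<epsilon>\<^sup>2 = 1"
    using z by (simp add: power2_eq_square)
  then have eps: "\<epsilon> = 1 \<or> \<epsilon> = - 1"
    by (rule power2_eq_1_iff[THEN iffD1])
  have eps': "\<epsilon> = (- 1) ^ l" if "l \<le> 1"
    using par[OF that, of z] parity[of z] z by simp
  define D where "D k y = (d_y ^^ k) (wt m g) (0, y)" for k y
  have "smooth ((d_y ^^ k) (wt m g))" for k
    by (induction k) (simp_all add: smooth smooth_d_y)
  then have D: "(D k has_vector_derivative D (Suc k) y) (at y)" for k y
    unfolding D_def using has_vector_derivative_d_y[OF smooth_imp_differentiable] by simp
  obtain c where c: "\<And>y. D 0 y = c * weight_fun l m (of_real y)" "\<epsilon> \<noteq> (- 1) ^ l \<Longrightarrow> c = 0"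
  proof (rule weight_ode_solution[of D m l \<epsilon>, OF D])
    show "(of_real y)\<^sup>2 * (of_int m * D 0 y - (of_real y)\<^sup>2 * D 0 y + D 2 y)
        = of_nat l * (of_nat l - 1) * D 0 y" for y
      using ode[of y] by (simp add: D_def numeral_2_eq_2)
    show "D 0 (- y) = \<epsilon> * D 0 y" for y
      using parity by (simp add: D_def)
  qed (use eps eps' in auto)
  show ?thesis
  proof (rule that)
    have "g = (\<lambda>y. c * weight_fun l m (of_real y))"
      using c(1) by (simp add: D_def fun_eq_iff)
    then show "wt m g = cscale c (wvec l m)"
      by (simp only: wvec_def wt_cmult)
    assume "c \<noteq> 0"
    then have "\<i> powi (m - q) = (- 1) ^ l"
      using c(2) by (auto simp: \<epsilon>_def)
    also have "\<dots> = \<i> powi (2 * int l)"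
      by (simp add: power_int_mult)
    finally have "\<i> powi (m - q - 2 * int l) = 1"
      by (simp add: power_int_diff[of _ "m - q"])
    then show "m \<in> weights q l"
      by (simp add: weights_def i_powi_eq_1_iff)
  qed
qed

text \<open>The eigenvalue equation and, for l <= 1, the parity condition hold for the sum of the
  components; independence of the exponentials in theta transfers them to each component, where the
  radial uniqueness result applies.\<close>

lemma H_space_weight_expansion:
  assumes "F \<in> H_space q l"
  obtains M c where "finite M" "M \<subseteq> weights q l" "F = (\<Sum>m\<in>M. cscale (c m) (wvec l m))"
proof -
  have "K_finite q F"
    using assms by (simp add: H_space_def)
  then obtain M g where M: "finite M" and F: "F = (\<Sum>m\<in>M. wt m (g m))" and I: "\<And>m. wt m (g m) \<in> I_cpt q"
    using K_finite_weight_decomposition by metis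
  have smooth: "smooth (wt m (g m))" for m
    using I by (simp add: I_cpt_def)
  define h where "h m y = (of_real y)\<^sup>2 * (of_int m * g m y - (of_real y)\<^sup>2 * g m y
      + d_y (d_y (wt m (g m))) (0, y))" for m y
  have "Omega_op F = cscale (of_nat l * (of_nat l - 1)) F"
    using assms by (simp add: H_space_def Omega_ker_def)
  moreover have "Omega_op F = (\<Sum>m\<in>M. wt m (h m))"
    using Omega_op_sum[of M "\<lambda>m. wt m (g m)"] smooth by (simp add: F Omega_op_wt h_def[abs_def])
  ultimately have "(\<Sum>m\<in>M. wt m (\<lambda>y. h m y + (- (of_nat l * (of_nat l - 1))) * g m y)) = 0"
    unfolding wt_add wt_cmult sum.distrib by (simp add: F cfun.scale_sum_right sum_negf)
  then have ode: "h m y = of_nat l * (of_nat l - 1) * g m y" if "m \<in> M" for m y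
    using sum_wt_eq_0[OF M, where n = m and y = y] that by fastforce
  have par: "g m (- y) = (- 1) ^ l * g m y" if "l \<le> 1" "m \<in> M" for m y
  proof -
    have "F (\<theta>, - y) = (- 1) ^ l * F (\<theta>, y)" for \<theta> y
      using assms \<open>l \<le> 1\<close> by (auto simp: H_space_def le_Suc_eq)
    then have "(\<Sum>m\<in>M. wt m (\<lambda>y. g m (- y) - (- 1) ^ l * g m y)) = 0"
      by (auto simp: F fun_eq_iff sum_fun_apply wt_def algebra_simps sum_subtractf sum_distrib_left)
    from sum_wt_eq_0[OF M this \<open>m \<in> M\<close>] show ?thesis by simp
  qed
  have "\<exists>c. wt m (g m) = cscale c (wvec l m) \<and> (c \<noteq> 0 \<longrightarrow> m \<in> weights q l)" if "m \<in> M" for m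
    using weight_solution[OF I, of m l] ode[OF that] par that unfolding h_def by metis
  then obtain c where c: "\<And>m. m \<in> M \<Longrightarrow> wt m (g m) = cscale (c m) (wvec l m) \<and> (c m \<noteq> 0 \<longrightarrow> m \<in> weights q l)"
    by metis
  have "F = (\<Sum>m\<in>M. cscale (c m) (wvec l m))"
    unfolding F using c by (intro sum.cong) auto
  also have "\<dots> = (\<Sum>m\<in>M \<inter> weights q l. cscale (c m) (wvec l m))"
    using M c by (intro sum.mono_neutral_right) (auto simp del: zero_fun_apply)
  finally show ?thesis
    using M by (intro that[of "M \<inter> weights q l" c]) auto
qed

lemma H_space_eq_span: "H_space q l = cfun.span (wvec l ` weights q l)"
proof (rule antisym)
  show "cfun.span (wvec l ` weights q l) \<subseteq> H_space q l"
    by (rule cfun.span_minimal) (auto simp: wvec_in_H_space H_space_subspace)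
  show "H_space q l \<subseteq> cfun.span (wvec l ` weights q l)"
  proof
    fix F assume "F \<in> H_space q l"
    then obtain M c where "finite M" "M \<subseteq> weights q l" "F = (\<Sum>m\<in>M. cscale (c m) (wvec l m))"
      by (rule H_space_weight_expansion)
    then show "F \<in> cfun.span (wvec l ` weights q l)"
      by (simp only:) (rule cfun.span_sum, rule cfun.span_scale, rule cfun.span_base, auto)
  qed
qed

lemma smooth_H_space: "F \<in> H_space q l \<Longrightarrow> smooth F"
  by (simp add: H_space_def Omega_ker_def I_cpt_def)

text \<open>Reduces linear statements about H_l to the vectors \<open>wvec l m\<close>. The
  membership premises of the last two cases supply the smoothness that linearity of the operators
  requires.\<close>

lemma H_space_induct [consumes 1, case_names basis zero add scale]:
  assumes "F \<in> H_space q l"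
    and "\<And>m. m \<in> weights q l \<Longrightarrow> P (wvec l m)" and "P 0"
    and "\<And>F G. F \<in> H_space q l \<Longrightarrow> G \<in> H_space q l \<Longrightarrow> P F \<Longrightarrow> P G \<Longrightarrow> P (F + G)"
    and "\<And>c F. F \<in> H_space q l \<Longrightarrow> P F \<Longrightarrow> P (cscale c F)"
  shows "P F"
proof -
  have "cfun.subspace {F \<in> H_space q l. P F}"
    using assms(3-) H_space_subspace[of q l]
    by (intro cfun.subspaceI) (auto simp: cfun.subspace_0 cfun.subspace_add cfun.subspace_scale)
  moreover have "wvec l ` weights q l \<subseteq> {F \<in> H_space q l. P F}"
    using assms(2) wvec_in_H_space by auto
  ultimately have "cfun.span (wvec l ` weights q l) \<subseteq> {F \<in> H_space q l. P F}"
    by (intro cfun.span_minimal)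
  then show ?thesis
    using assms(1) unfolding H_space_eq_span[of q l, symmetric] by auto
qed

section \<open>The module structure in the weight basis\<close>

lemma sl2_act_wvec: "sl2_act X (wvec l m)
  = cscale (kappa_coord X * (of_int m / 2)) (wvec l m)
    + cscale (eta_plus_coord X * (- (2 * of_nat l + 1 + of_int m) / 4)) (wvec l (m + 4))
    + cscale (eta_minus_coord X * (- (2 * of_nat l + 1 - of_int m) / 4)) (wvec l (m - 4))"
  by (simp only: sl2_act_def kappa_op_wvec eta_plus_op_wvec eta_minus_op_wvec cfun.scale_scale)

text \<open>These encode \<open>[kappa, eta^+] = 2 eta^+\<close>,
  \<open>[kappa, eta^-] = - 2 eta^-\<close> and \<open>[eta^+, eta^-] = kappa\<close>.\<close>

lemma bracket_coords:
  assumes "X \<in> sl2" "Y \<in> sl2"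
  shows "kappa_coord (lie_bracket X Y)
      = eta_plus_coord X * eta_minus_coord Y - eta_minus_coord X * eta_plus_coord Y"
    and "eta_plus_coord (lie_bracket X Y)
      = 2 * (kappa_coord X * eta_plus_coord Y - eta_plus_coord X * kappa_coord Y)"
    and "eta_minus_coord (lie_bracket X Y)
      = - 2 * (kappa_coord X * eta_minus_coord Y - eta_minus_coord X * kappa_coord Y)"
proof -
  have "X $ 2 $ 2 = - X $ 1 $ 1" "Y $ 2 $ 2 = - Y $ 1 $ 1"
    using assms by (simp_all add: sl2_def trace_def sum_2 add_eq_0_iff)
  then show "kappa_coord (lie_bracket X Y)
      = eta_plus_coord X * eta_minus_coord Y - eta_minus_coord X * eta_plus_coord Y"
    "eta_plus_coord (lie_bracket X Y)
      = 2 * (kappa_coord X * eta_plus_coord Y - eta_plus_coord X * kappa_coord Y)"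
    "eta_minus_coord (lie_bracket X Y)
      = - 2 * (kappa_coord X * eta_minus_coord Y - eta_minus_coord X * kappa_coord Y)"
    by (simp_all add: kappa_coord_def eta_plus_coord_def eta_minus_coord_def lie_bracket_def
        matrix_matrix_mult_def sum_2) (simp_all add: field_simps)
qed

lemma sl2_act_H_space:
  assumes "F \<in> H_space q l"
  shows "sl2_act X F \<in> H_space q l"
  using assms
proof (induction rule: H_space_induct)
  case (basis m)
  then have "m + 4 \<in> weights q l" "m - 4 \<in> weights q l"
    unfolding weights_def mem_Collect_eq by presburger+
  with basis show ?case
    unfolding sl2_act_wvec
    by (intro cfun.subspace_add[OF H_space_subspace] cfun.subspace_scale[OF H_space_subspace] wvec_in_H_space)
next
  case zero
  have "sl2_act X 0 = 0"
    using sl2_act_cscale[OF smooth_wvec, of X 0 0 0] by (simp del: zero_fun_apply)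
  then show ?case
    by (simp add: cfun.subspace_0[OF H_space_subspace] del: zero_fun_apply)
next
  case (add F G)
  then show ?case
    by (metis sl2_act_add smooth_H_space cfun.subspace_add[OF H_space_subspace])
next
  case (scale c F)
  then show ?case
    by (simp add: sl2_act_cscale[OF smooth_H_space] cfun.subspace_scale[OF H_space_subspace])
qed

text \<open>On \<open>wvec l m\<close> both sides are combinations of the vectors of weights m, m +
  4, m - 4, m + 8 and m - 8; the last two cancel in the commutator and the others match by the
  structure constants.\<close>

lemma sl2_act_bracket:
  assumes F: "F \<in> H_space q l" and X: "X \<in> sl2" and Y: "Y \<in> sl2"
  shows "sl2_act (lie_bracket X Y) F = sl2_act X (sl2_act Y F) - sl2_act Y (sl2_act X F)"
  using F
proof (induction rule: H_space_induct)
  case (basis m)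
  have act: "sl2_act X (sl2_act Y (wvec l m))
      = cscale (kappa_coord Y * (of_int m / 2)) (sl2_act X (wvec l m))
      + cscale (eta_plus_coord Y * (- (2 * of_nat l + 1 + of_int m) / 4)) (sl2_act X (wvec l (m + 4)))
      + cscale (eta_minus_coord Y * (- (2 * of_nat l + 1 - of_int m) / 4)) (sl2_act X (wvec l (m - 4)))" for X Y
    unfolding sl2_act_wvec[of Y]
    by (simp only: sl2_act_add sl2_act_cscale smooth_wvec smooth_add smooth_cscale)
  show ?case
    unfolding act unfolding sl2_act_wvec bracket_coords[OF X Y]
    by (auto simp: fun_eq_iff cscale_def) (simp add: field_simps)
next
  case zero
  have "sl2_act X 0 = 0" for X
    using sl2_act_cscale[OF smooth_wvec, of X 0 0 0] by (simp del: zero_fun_apply)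
  then show ?case
    by (simp del: zero_fun_apply)
next
  case (add F G)
  then have "smooth F" "smooth G" "smooth (sl2_act X F)" "smooth (sl2_act X G)"
    "smooth (sl2_act Y F)" "smooth (sl2_act Y G)"
    by (auto intro: smooth_H_space sl2_act_H_space)
  then show ?case
    by (simp only: sl2_act_add add.IH add_diff_add)
next
  case (scale c F)
  then have "smooth F" "smooth (sl2_act X F)" "smooth (sl2_act Y F)"
    by (auto intro: smooth_H_space sl2_act_H_space)
  then show ?case
    by (simp only: sl2_act_cscale scale.IH cfun.scale_right_diff_distrib)
qed

lemma sl2_module_H_space: "sl2_module (H_space q l)"
  unfolding sl2_module_def
proof (intro conjI ballI allI)
  fix X Y F assume "X \<in> sl2" "Y \<in> sl2" "F \<in> H_space q l"
  show "sl2_act (X + Y) F = sl2_act X F + sl2_act Y F"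
    by (simp add: fun_eq_iff sl2_act_def cscale_def kappa_coord_def eta_plus_coord_def eta_minus_coord_def field_simps)
next
  fix X F c assume "X \<in> sl2" "F \<in> H_space q l"
  show "sl2_act (map_matrix ((*) c) X) F = cscale c (sl2_act X F)"
    by (simp add: fun_eq_iff sl2_act_def cscale_def kappa_coord_def eta_plus_coord_def eta_minus_coord_def field_simps)
qed (simp_all add: H_space_subspace sl2_act_H_space sl2_act_bracket sl2_act_add sl2_act_cscale smooth_H_space)


section \<open>Submodules\<close>

text \<open>A submodule is stable under kappa, whose eigenvalues m/2 are distinct, so it contains
  every weight component of its elements.\<close>

lemma wvec_in_submodule:
  assumes W: "sl2_submodule W (H_space q l)"
    and M: "finite M" "(\<Sum>m\<in>M. cscale (c m) (wvec l m)) \<in> W" "n \<in> M" "c n \<noteq> 0"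
  shows "wvec l n \<in> W"
proof -
  have sub: "cfun.subspace W" and kap: "\<And>F. F \<in> W \<Longrightarrow> kappa_op F \<in> W"
    using W sl2_basis_in_sl2(1) sl2_act_kappa by (auto simp: sl2_submodule_def)
  have "cscale (c n) (wvec l n) \<in> W"
    using weight_components_in_subspace[OF sub kap M(1), of "\<lambda>m y. c m * weight_fun l m (of_real y)" n] M(2,3)
    by (simp add: wt_cmult flip: wvec_def)
  then have "cscale (1 / c n) (cscale (c n) (wvec l n)) \<in> W"
    using sub by (simp only: cfun.subspace_scale)
  then show ?thesis
    using M(4) by simp
qed

lemma raising_coeff_eq_0:
  "- (2 * of_nat l + 1 + of_int m) / 4 = (0 :: complex) \<longleftrightarrow> m = - (2 * int l + 1)"
proof -
  have "- (2 * of_nat l + 1 + of_int m) / 4 = (of_int (- (2 * int l + 1 + m)) / 4 :: complex)"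
    by simp
  also have "\<dots> = 0 \<longleftrightarrow> - (2 * int l + 1 + m) = 0"
    by (simp only: divide_eq_0_iff of_int_eq_0_iff) simp
  finally show ?thesis by presburger
qed

lemma lowering_coeff_eq_0:
  "- (2 * of_nat l + 1 - of_int m) / 4 = (0 :: complex) \<longleftrightarrow> m = 2 * int l + 1"
proof -
  have "- (2 * of_nat l + 1 - of_int m) / 4 = (of_int (- (2 * int l + 1 - m)) / 4 :: complex)"
    by simp
  also have "\<dots> = 0 \<longleftrightarrow> - (2 * int l + 1 - m) = 0"
    by (simp only: divide_eq_0_iff of_int_eq_0_iff) simp
  finally show ?thesis by presburger
qed

text \<open>A nonzero submodule contains some \<open>wvec l n\<close>. For even q all weights are
  even, while the ladder coefficients vanish only at odd ones, so the ladder reaches the whole class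
  of n modulo 4.\<close>

lemma H_space_irreducible:
  assumes "even q"
  shows "sl2_irreducible (H_space q l)"
  unfolding sl2_irreducible_def
proof (intro conjI allI impI)
  have "q + 2 * int l \<in> weights q l"
    by (simp add: weights_def)
  then show "H_space q l \<noteq> {0}"
    using wvec_in_H_space wvec_nonzero by blast
next
  fix W assume W: "sl2_submodule W (H_space q l)"
  have sub: "cfun.subspace W" and act: "\<And>X F. X \<in> sl2 \<Longrightarrow> F \<in> W \<Longrightarrow> sl2_act X F \<in> W" and WV: "W \<subseteq> H_space q l"
    using W by (auto simp: sl2_submodule_def)
  have scale: "F \<in> W" if "cscale c F \<in> W" "c \<noteq> 0" for c F
    using cfun.subspace_scale[OF sub that(1), of "1 / c"] that(2) by simp
  have plus: "wvec l (m + 4) \<in> W" if "wvec l m \<in> W" "even m" for m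
  proof -
    have "- (2 * of_nat l + 1 + of_int m) / 4 \<noteq> (0 :: complex)"
      unfolding raising_coeff_eq_0 using that(2) by presburger
    moreover have "eta_plus_op (wvec l m) \<in> W"
      using act[OF sl2_basis_in_sl2(2) that(1)] by (simp add: sl2_act_eta_plus)
    ultimately show ?thesis
      unfolding eta_plus_op_wvec by (rule scale[rotated])
  qed
  have minus: "wvec l (m - 4) \<in> W" if "wvec l m \<in> W" "even m" for m
  proof -
    have "- (2 * of_nat l + 1 - of_int m) / 4 \<noteq> (0 :: complex)"
      unfolding lowering_coeff_eq_0 using that(2) by presburger
    moreover have "eta_minus_op (wvec l m) \<in> W"
      using act[OF sl2_basis_in_sl2(3) that(1)] by (simp add: sl2_act_eta_minus)
    ultimately show ?thesis
      unfolding eta_minus_op_wvec by (rule scale[rotated])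
  qed
  show "W = {0} \<or> W = H_space q l"
  proof (cases "W \<subseteq> {0}")
    case True
    then show ?thesis
      using cfun.subspace_0[OF sub] by blast
  next
    case False
    then obtain F where F: "F \<in> W" "F \<noteq> 0" by blast
    have "F \<in> H_space q l"
      using F(1) WV by blast
    then obtain M c where M: "finite M" "M \<subseteq> weights q l" "F = (\<Sum>m\<in>M. cscale (c m) (wvec l m))"
      by (rule H_space_weight_expansion)
    have "F = 0" if "\<forall>n\<in>M. c n = 0"
      unfolding M(3) using that by (intro sum.neutral) (simp del: zero_fun_apply)
    then obtain n where n: "n \<in> M" "c n \<noteq> 0"
      using F(2) by blast
    have wn: "wvec l n \<in> W"
      using F(1) unfolding M(3) by (rule wvec_in_submodule[of W q l M c n, OF W M(1) _ n])
    have "4 dvd n - q - 2 * int l"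
      using n M(2) by (auto simp: weights_def)
    with assms have "even n"
      by presburger
    have all: "wvec l (n + 4 * k) \<in> W" for k :: int
    proof (induction k rule: int_induct[of _ 0])
      case base
      then show ?case using wn by simp
    next
      case (step1 i)
      then show ?case
        using plus[of "n + 4 * i"] \<open>even n\<close> by (simp add: algebra_simps)
    next
      case (step2 i)
      then show ?case
        using minus[of "n + 4 * i"] \<open>even n\<close> by (simp add: algebra_simps)
    qed
    have "wvec l m \<in> W" if "m \<in> weights q l" for m
    proof -
      have "4 dvd m - n"
        using that \<open>4 dvd n - q - 2 * int l\<close> unfolding weights_def mem_Collect_eq by presburger
      then obtain k where "m - n = 4 * k" by (elim dvdE)
      then show ?thesis
        using all[of k] by (simp add: algebra_simps)
    qed
    then have "H_space q l \<subseteq> W"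
      unfolding H_space_eq_span using sub by (intro cfun.span_minimal) auto
    with WV show ?thesis by blast
  qed
qed (rule sl2_module_H_space)

section \<open>Submodules generated by extremal weight vectors\<close>

lemma submodule_generated_by_submodule:
  assumes "sl2_module V" "v \<in> V"
  shows "sl2_submodule (submodule_generated_by V v) V"
proof -
  have V: "sl2_submodule V V"
    using assms(1) by (simp add: sl2_submodule_def sl2_module_def)
  have "cfun.subspace (submodule_generated_by V v)"
    unfolding submodule_generated_by_def by (rule cfun.subspace_Inter) (auto simp: sl2_submodule_def)
  moreover have "submodule_generated_by V v \<subseteq> V"
    using V assms(2) by (auto simp: submodule_generated_by_def)
  moreover have "sl2_act X F \<in> submodule_generated_by V v" if "X \<in> sl2" "F \<in> submodule_generated_by V v" for X F
    using that by (auto simp: submodule_generated_by_def sl2_submodule_def)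
  ultimately show ?thesis
    using assms(1) by (simp add: sl2_submodule_def)
qed

lemma submodule_generated_by_cscale:
  assumes "c \<noteq> 0"
  shows "submodule_generated_by V (cscale c v) = submodule_generated_by V v"
proof -
  have "cscale c v \<in> W \<longleftrightarrow> v \<in> W" if "sl2_submodule W V" for W
  proof -
    have "cfun.subspace W" using that by (simp add: sl2_submodule_def)
    then have "d \<noteq> 0 \<Longrightarrow> u \<in> W \<Longrightarrow> cscale d u \<in> W" for d u
      by (simp add: cfun.subspace_scale)
    from this[of c v] this[of "1 / c" "cscale c v"] show ?thesis
      using assms by auto
  qed
  then show ?thesis
    unfolding submodule_generated_by_def by (metis (no_types, lifting))
qed

text \<open>Serves both extremal cases, with X = eta^- or X = eta^+. Proportional nonzero vectors
  generate the same submodule, so a one-dimensional kernel of X gives uniqueness.\<close>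

lemma unique_extremal_submodule:
  assumes V: "sl2_module V" and v: "v \<in> V" "\<exists>m. weight_vector m v" "sl2_act X v = 0"
    and unique: "\<And>u. u \<in> V \<Longrightarrow> u \<noteq> 0 \<Longrightarrow> sl2_act X u = 0 \<Longrightarrow> \<exists>c. u = cscale c v"
  shows "\<exists>!W. sl2_submodule W V \<and> (\<exists>u\<in>V. (\<exists>m. weight_vector m u) \<and> sl2_act X u = 0
           \<and> W = submodule_generated_by V u)"
proof (rule ex1I[of _ "submodule_generated_by V v"])
  show "sl2_submodule (submodule_generated_by V v) V \<and> (\<exists>u\<in>V. (\<exists>m. weight_vector m u) \<and> sl2_act X u = 0
           \<and> submodule_generated_by V v = submodule_generated_by V u)"
    using submodule_generated_by_submodule[OF V v(1)] v by blast
next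
  fix W assume "sl2_submodule W V \<and> (\<exists>u\<in>V. (\<exists>m. weight_vector m u) \<and> sl2_act X u = 0
           \<and> W = submodule_generated_by V u)"
  then obtain u m where u: "u \<in> V" "weight_vector m u" "sl2_act X u = 0" "W = submodule_generated_by V u"
    by blast
  then have "u \<noteq> 0"
    by (simp add: weight_vector_def)
  with unique u obtain c where "u = cscale c v" by blast
  with \<open>u \<noteq> 0\<close> have "c \<noteq> 0"
    by (metis cfun.scale_zero_left)
  then show "W = submodule_generated_by V v"
    using u(4) \<open>u = cscale c v\<close> submodule_generated_by_cscale by simp
qed

text \<open>The images of distinct weight vectors have distinct weights and are independent, so
  \<open>c m * a m = 0\<close> for every m, and only m = n can survive.\<close>

lemma kernel_of_weight_shift:
  assumes u: "u \<in> H_space q l"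
    and X: "\<And>m. sl2_act X (wvec l m) = cscale (a m) (wvec l (m + k))"
    and a: "\<And>m. a m = 0 \<Longrightarrow> m = n"
    and "sl2_act X u = 0"
  shows "\<exists>c. u = cscale c (wvec l n)"
proof -
  from u obtain M c where M: "finite M" and "M \<subseteq> weights q l"
    and uM: "u = (\<Sum>m\<in>M. cscale (c m) (wvec l m))"
    by (rule H_space_weight_expansion)
  have act0: "sl2_act X 0 = 0"
    using sl2_act_cscale[OF smooth_wvec, of X 0 0 0] by (simp del: zero_fun_apply)
  have smooth0: "smooth 0"
    using smooth_cscale[OF smooth_wvec, of 0] by (simp del: zero_fun_apply)
  have "sl2_act X (\<Sum>m\<in>M. cscale (c m) (wvec l m)) = (\<Sum>m\<in>M. cscale (c m) (sl2_act X (wvec l m)))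
      \<and> smooth (\<Sum>m\<in>M. cscale (c m) (wvec l m))"
    using M by (induction M) (simp_all add: act0 smooth0 sl2_act_add sl2_act_cscale smooth_add smooth_cscale smooth_wvec
        del: zero_fun_apply plus_fun_apply)
  then have "0 = (\<Sum>m\<in>M. cscale (c m * a m) (wvec l (m + k)))"
    using \<open>sl2_act X u = 0\<close> by (simp add: uM X)
  \<comment> \<open>Reindexing by the shifted weight brings the sum into the form of
    \<open>sum_wt_eq_0\<close>.\<close>
  also have "\<dots> = (\<Sum>m\<in>(\<lambda>m. m + k) ` M. wt m (\<lambda>y. (c (m - k) * a (m - k)) * weight_fun l m (of_real y)))"
    by (subst sum.reindex) (auto simp: wt_cmult inj_on_def simp flip: wvec_def)
  finally have zero: "(\<Sum>m\<in>(\<lambda>m. m + k) ` M. wt m (\<lambda>y. (c (m - k) * a (m - k)) * weight_fun l m (of_real y))) = 0"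
    by (rule sym)
  have c0: "c m = 0" if "m \<in> M" "m \<noteq> n" for m
  proof -
    have "(c m * a m) * weight_fun l (m + k) (of_real y) = 0" for y
      using sum_wt_eq_0[OF _ zero, of "m + k" y] that(1) M by auto
    moreover obtain y where "weight_fun l (m + k) (of_real y) \<noteq> 0"
      using wvec_nonzero[of l "m + k"] by (auto simp: wvec_def wt_eq_0_iff)
    ultimately show ?thesis
      using a[of m] that(2) by force
  qed
  have "u = (\<Sum>m\<in>M. if m = n then cscale (c n) (wvec l n) else 0)"
    unfolding uM using c0 by (intro sum.cong) (auto simp del: zero_fun_apply)
  \<comment> \<open>The second alternative covers the case that n is not in
    \<open>M\<close>.\<close>
  then have "u = cscale (c n) (wvec l n) \<or> u = cscale 0 (wvec l n)"
    using M by (auto simp del: zero_fun_apply split: if_splits)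
  then show ?thesis by blast
qed

theorem theorem1:
  fixes l :: nat and q :: int
  assumes "q \<in> {0, 1, 2, 3}"
  shows "(q = 0 \<or> q = 2 \<longrightarrow> sl2_irreducible (H_space q l))
    \<and> (q = 1 \<longrightarrow> (\<exists>!W. lowest_weight_submodule (H_space q l) W))
    \<and> (q = 3 \<longrightarrow> (\<exists>!W. highest_weight_submodule (H_space q l) W))"
proof (intro conjI impI)
  assume "q = 0 \<or> q = 2"
  then show "sl2_irreducible (H_space q l)"
    by (intro H_space_irreducible) auto
next
  assume q: "q = 1"
  let ?n = "2 * int l + 1"
  \<comment> \<open>Written as \<open>m + - 4\<close> to match the shift \<open>m + k\<close> with k
    = -4.\<close>
  have act: "sl2_act sl2_eta_minus (wvec l m) = cscale (- (2 * of_nat l + 1 - of_int m) / 4) (wvec l (m + - 4))" for m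
    unfolding sl2_act_eta_minus eta_minus_op_wvec by simp
  have "sl2_act sl2_eta_minus (wvec l ?n) = 0"
    unfolding act by (simp del: zero_fun_apply)
  moreover have "wvec l ?n \<in> H_space q l"
    by (rule wvec_in_H_space) (simp add: weights_def q)
  ultimately show "\<exists>!W. lowest_weight_submodule (H_space q l) W"
    unfolding lowest_weight_submodule_def
    using weight_vector_wvec kernel_of_weight_shift[OF _ act lowering_coeff_eq_0[THEN iffD1]]
    by (intro unique_extremal_submodule[of _ "wvec l ?n"] sl2_module_H_space) blast+
next
  assume q: "q = 3"
  let ?n = "- (2 * int l + 1)"
  have act: "sl2_act sl2_eta_plus (wvec l m) = cscale (- (2 * of_nat l + 1 + of_int m) / 4) (wvec l (m + 4))" for m
    unfolding sl2_act_eta_plus by (rule eta_plus_op_wvec)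
  have "sl2_act sl2_eta_plus (wvec l ?n) = 0"
    unfolding act by (simp del: zero_fun_apply)
  \<comment> \<open>Here \<open>?n - q - 2 * int l\<close> equals -4 (l + 1).\<close>
  moreover have "wvec l ?n \<in> H_space q l"
    by (rule wvec_in_H_space) (simp add: weights_def q)
  ultimately show "\<exists>!W. highest_weight_submodule (H_space q l) W"
    unfolding highest_weight_submodule_def
    using weight_vector_wvec kernel_of_weight_shift[OF _ act raising_coeff_eq_0[THEN iffD1]]
    by (intro unique_extremal_submodule[of _ "wvec l ?n"] sl2_module_H_space) blast+
qed

end
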